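(* Let $k=k_n$ depend on $n$ and suppose that $k\to+\infty$ and $k/n\to 0$ as $n\to+\infty$, that $0<\mu\leq M$ on $[0,1]$ for a constant $M$, and that $s$ is $C$-Lipschitz on $[0,1]$. Then the risk of a purely uniformly random tree (PURT) satisfies $$\mathbb{E}\big[(\hat{s}_{\mathbb{U}}(X)-s(X))^2\big]\leq \frac{\sigma^2(k+1)}{n}+\frac{6MC^2}{(k+1)^2}+o\Big(\frac{k}{n}\Big)\quad (n\to+\infty).$$
   Context: Model: $(X_1,Y_1),\dots,(X_n,Y_n)$ are i.i.d. copies of $(X,Y)$ (the learning sample $\mathcal{L}_n$), with $Y_i=s(X_i)+\varepsilon_i$, where $s:[0,1]\to\mathbb{R}$ is the (fixed, unknown) regression function, $X\in[0,1]$ has a continuous density $\mu$ on $[0,1]$, and $\varepsilon_1,\dots,\varepsilon_n$ are i.i.d. copies of a real random variable $\varepsilon$, independent of $(X_1,\dots,X_n)$, with $\mathbb{E}[\varepsilon]=0$ and $\mathrm{Var}(\varepsilon)=\sigma^2$. In risks, $X$ denotes a new point with density $\mu$, independent of $\mathcal{L}_n$ and of the random partition. Tree: for a natural integer $k$ (depending on $n$), $\mathbb{U}=(U_1,\dots,U_k)$ are i.i.d. uniform on $[0,1]$, independent of $\mathcal{L}_n$ and $X$; $U_{(1)}\leq\dots\leq U_{(k)}$ are their order statistics, $U_{(0)}=0$, $U_{(k+1)}=1$. The purely uniformly random tree (PURT) is the estimator, for $x\in[0,1]$, $$\hat{s}_{\mathbb{U}}(x)=\sum_{j=0}^k\hat\beta_j\mathbf{1}_{U_{(j)}<x\leq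 U_{(j+1)}},\qquad \hat\beta_j=\frac{1}{\#\{i:U_{(j)}<X_i\leq U_{(j+1)}\}}\sum_{i:\,U_{(j)}<X_i\leq U_{(j+1)}}Y_i,$$ with $\hat\beta_j=0$ if the cell $(U_{(j)},U_{(j+1)}]$ contains no $X_i$. The notation $o(k/n)$ denotes a function $f(n)$ with $f(n)/(k/n)\to0$ as $n\to+\infty$. *)

theory Defs
  imports "HOL-Probability.Probability" "HOL-Library.Landau_Symbols"
begin

text \<open>
  \<open>order_stat u k j\<close> is \<open>U\<^sub>(\<^sub>j\<^sub>)\<close> for the split points \<open>u 1, \<dots>, u k\<close>, with the conventions
  \<open>U\<^sub>(\<^sub>0\<^sub>) = 0\<close> and \<open>U\<^sub>(\<^sub>k\<^sub>+\<^sub>1\<^sub>) = 1\<close>.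
\<close>

definition order_stat :: "(nat \<Rightarrow> real) \<Rightarrow> nat \<Rightarrow> nat \<Rightarrow> real" where
  "order_stat u k j =
     (if j = 0 then 0 else if j \<le> k then sort (map u [1..<Suc k]) ! (j - 1) else 1)"

definition cell :: "(nat \<Rightarrow> real) \<Rightarrow> nat \<Rightarrow> nat \<Rightarrow> real set" where
  "cell u k j = {order_stat u k j <.. order_stat u k (Suc j)}"

text \<open>If no design point lies in the cell \<open>A\<close>, the value below is \<open>0 / 0 = 0\<close>, as required.\<close>

definition cell_mean :: "nat \<Rightarrow> (nat \<Rightarrow> real) \<Rightarrow> (nat \<Rightarrow> real) \<Rightarrow> real set \<Rightarrow> real" where
  "cell_mean n x y A = (\<Sum>i | i \<in> {1..n} \<and> x i \<in> A. y i) / real (card {i \<in> {1..n}. x i \<in> A})"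

definition purt :: "nat \<Rightarrow> nat \<Rightarrow> (nat \<Rightarrow> real) \<Rightarrow> (nat \<Rightarrow> real) \<Rightarrow> (nat \<Rightarrow> real) \<Rightarrow> real \<Rightarrow> real" where
  "purt n k x y u t = (\<Sum>j=0..k. cell_mean n x y (cell u k j) * indicator (cell u k j) t)"

datatype source = Design nat | Noise nat | Split nat | New_Point

text \<open>
  The randomness for one sample size \<open>n\<close>: design points \<open>X 1, \<dots>, X n\<close>, noise \<open>\<epsilon> 1, \<dots>, \<epsilon> n\<close>
  with law \<open>\<nu>\<close>, split points \<open>U 1, \<dots>, U k\<close> and the new point \<open>X'\<close>. The independence
  requirements (i.i.d. design; i.i.d. noise independent of the design; i.i.d. splits independent
  of the sample and of the new point; new point independent of the sample and of the splits)
  together say exactly that all these variables are mutually independent.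
\<close>

locale purt_model = prob_space P
  for P :: "'a measure" +
  fixes n k :: nat
    and \<mu> :: "real \<Rightarrow> real"
    and \<nu> :: "real measure"
    and X \<epsilon> U :: "nat \<Rightarrow> 'a \<Rightarrow> real"
    and X' :: "'a \<Rightarrow> real"
  assumes indep: "indep_vars (\<lambda>_. borel)
      (\<lambda>v. case v of Design i \<Rightarrow> X i | Noise i \<Rightarrow> \<epsilon> i | Split j \<Rightarrow> U j | New_Point \<Rightarrow> X')
      (Design ` {1..n} \<union> Noise ` {1..n} \<union> Split ` {1..k} \<union> {New_Point})"
    and X_range: "\<And>i \<omega>. i \<in> {1..n} \<Longrightarrow> \<omega> \<in> space P \<Longrightarrow> X i \<omega> \<in> {0..1}"
    and X'_range: "\<And>\<omega>. \<omega> \<in> space P \<Longrightarrow> X' \<omega> \<in> {0..1}"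
    and X_density: "\<And>i. i \<in> {1..n} \<Longrightarrow>
      distributed P lborel (X i) (\<lambda>x. ennreal (\<mu> x * indicator {0..1} x))"
    and X'_density: "distributed P lborel X' (\<lambda>x. ennreal (\<mu> x * indicator {0..1} x))"
    and noise_law: "\<And>i. i \<in> {1..n} \<Longrightarrow> distr P borel (\<epsilon> i) = \<nu>"
    and U_uniform: "\<And>j. j \<in> {1..k} \<Longrightarrow> distr P lborel (U j) = uniform_measure lborel {0..1}"

end

theory Submission
  imports Defs
begin

text \<open>
  The risk splits over the cells of the tree. Once the split points are fixed, the cells
  \<open>A\<^sub>0, \<dots>, A\<^sub>k\<close> are deterministic disjoint intervals covering \<open>(0,1]\<close>, and in a cell of length \<open>l\<close>
  and mass \<open>p = P(X \<in> A)\<close> three errors compete. If the cell contains \<open>N > 0\<close> design points, the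
  average of the \<open>s(X\<^sub>i)\<close> differs from \<open>s(X)\<close> by at most \<open>C l\<close>, and averaging the noise adds a variance
  \<open>\<sigma>\<^sup>2/N\<close>. If \<open>N = 0\<close>, the estimate is \<open>0\<close> and the squared error is at most the supremum of \<open>s\<^sup>2\<close>.

  Since \<open>N\<close> is binomial with parameters \<open>n\<close> and \<open>p\<close>, the size-bias identity
  \<open>(n + 1) p E[f(N + 1)] = E[N' f(N')]\<close>, where \<open>N'\<close> is binomial with parameters \<open>n + 1\<close> and \<open>p\<close>, gives
  \<open>p E[1/(N + 1)] \<le> 1/n\<close> and \<open>p E[1/((N + 1)(N + 2))] \<le> min (1/n) (1/(n\<^sup>2 p))\<close>. As
  \<open>1/N \<le> 1/(N + 1) + 3/((N + 1)(N + 2))\<close> for \<open>N \<ge> 1\<close>, and the indicator of \<open>N = 0\<close> is at most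
  \<open>2/((N + 1)(N + 2))\<close>, each cell contributes \<open>\<sigma>\<^sup>2/n\<close> with the sharp constant, plus a multiple of
  \<open>(1/n) min 1 (1/(n p))\<close>, which is negligible unless the cell is short
  (\<open>expected_occupancy_loss_le\<close>, \<open>cell_risk_le\<close>). Adding up the \<open>k + 1\<close> cells produces the main variance
  term. It remains to average two functionals of the spacings.

  For the bias, \<open>p \<le> M l\<close> turns the sum into \<open>M C\<^sup>2\<close> times the expected sum of the \<open>l\<^sup>3\<close>. Writing \<open>l\<^sup>3\<close> as
  the integral of \<open>6(x - z)\<close> over \<open>z < x\<close> in the cell reduces this to the probability
  \<open>(1 - (x - z))\<^sup>k\<close> that no split separates \<open>z\<close> from \<open>x\<close>, and the resulting integral is at most
  \<open>6/((k + 1)(k + 2))\<close> (\<open>expectation_sum_cubed_lengths_le\<close>).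

  For the excess, let \<open>m > 0\<close> be the minimum of the continuous density. Cells longer than \<open>\<delta>\<close> have
  \<open>p \<ge> m \<delta>\<close>. A cell of length at most \<open>\<delta>\<close> is either the first or the last one, or it is delimited by two
  split points within distance \<open>\<delta>\<close> of each other, so on average there are at most
  \<open>2 + 2 k\<^sup>2 \<delta>\<close> of them (\<open>expectation_number_of_short_cells_le\<close>). With \<open>\<delta>\<close> the geometric mean of \<open>1/n\<close>
  and \<open>1/(k + 1)\<close>, the total excess is of order \<open>(k/n) (1/k + (k/n)\<^sup>1\<^sup>/\<^sup>2)\<close>, hence \<open>o(k/n)\<close>
  (\<open>remainder_smallo\<close>).

  Conditioning on the split points, the noise and the new point is expressed throughout by
  \<open>nn_integral_decouple\<close>: a function of two independent groups of variables may be integrated by drawing the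
  two groups from separate copies of the probability space.
\<close>

section \<open>Order statistics and cells\<close>

lemma order_stat_0 [simp]: "order_stat u k 0 = 0"
  by (simp add: order_stat_def)

lemma order_stat_gt [simp]: "k < j \<Longrightarrow> order_stat u k j = 1"
  by (simp add: order_stat_def)

text \<open>
  Representing the order statistics as \<open>u \<circ> \<pi>\<close> keeps track of indices: distinct positions correspond to
  distinct split points, also when some values coincide. The count of short cells relies on this.
\<close>

lemma order_stat_permutation:
  obtains \<pi> where "bij_betw \<pi> {1..k} {1..k}" "\<And>j. j \<in> {1..k} \<Longrightarrow> order_stat u k j = u (\<pi> j)"
proof -
  let ?xs = "map u [1..<Suc k]"
  obtain p where p: "p permutes {..<length ?xs}" "permute_list p ?xs = sort ?xs"
    using mset_eq_permutation[of "sort ?xs" ?xs] by auto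
  have bij_p: "bij_betw p {..<k} {..<k}"
    using permutes_imp_bij[OF p(1)] by (simp del: upt_Suc)
  have "bij_betw (\<lambda>j. j - 1) {1..k} {..<k}"
    by (rule bij_betw_byWitness[where f' = Suc]) auto
  moreover have "bij_betw Suc {..<k} {1..k}"
    by (rule bij_betw_byWitness[where f' = "\<lambda>j. j - 1"]) auto
  ultimately have bij: "bij_betw (Suc \<circ> (p \<circ> (\<lambda>j. j - 1))) {1..k} {1..k}"
    using bij_p by (meson bij_betw_trans)
  show thesis
  proof (rule that[OF bij])
    fix j assume j: "j \<in> {1..k}"
    then have pj: "p (j - 1) < k"
      using bij_p by (auto simp: bij_betw_def)
    have "order_stat u k j = permute_list p ?xs ! (j - 1)"
      using j p(2) by (simp add: order_stat_def)
    also have "\<dots> = ?xs ! p (j - 1)"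
      using j by (intro permute_list_nth[OF p(1)]) auto
    also have "\<dots> = u ((Suc \<circ> (p \<circ> (\<lambda>j. j - 1))) j)"
      using pj by (simp del: upt_Suc)
    finally show "order_stat u k j = u ((Suc \<circ> (p \<circ> (\<lambda>j. j - 1))) j)" .
  qed
qed

lemma order_stat_cong:
  assumes "\<And>j. j \<in> {1..k} \<Longrightarrow> u j = v j"
  shows "order_stat u k j = order_stat v k j"
proof -
  have "map u [1..<Suc k] = map v [1..<Suc k]"
    using assms by (intro map_cong) auto
  then show ?thesis
    by (simp only: order_stat_def)
qed

lemma order_stat_mem:
  assumes "u \<in> {1..k} \<rightarrow> {0..1}"
  shows "order_stat u k j \<in> {0..1}"
proof (cases "j \<in> {1..k}")
  case True
  obtain \<pi> where "bij_betw \<pi> {1..k} {1..k}" "\<And>j. j \<in> {1..k} \<Longrightarrow> order_stat u k j = u (\<pi> j)"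
    by (rule order_stat_permutation[of k u]) blast
  then show ?thesis
    using True Pi_mem[OF assms] bij_betwE by metis
next
  case False
  then have "j = 0 \<or> k < j" by auto
  then show ?thesis by auto
qed

lemma order_stat_mono:
  assumes u: "u \<in> {1..k} \<rightarrow> {0..1}" and "i \<le> j"
  shows "order_stat u k i \<le> order_stat u k j"
proof -
  consider "i = 0" | "k < j" | "0 < i" "j \<le> k" by linarith
  then show ?thesis
  proof cases
    case 3
    then show ?thesis
      using \<open>i \<le> j\<close> by (auto simp: order_stat_def simp del: upt_Suc intro!: sorted_nth_mono)
  qed (use order_stat_mem[OF u] in auto)
qed

text \<open>
  The event that an order statistic is at most \<open>a\<close> becomes a condition on the number of split points
  that are at most \<open>a\<close>; this count does not involve sorting, so its measurability is immediate.
\<close>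

lemma sorted_nth_le_iff_length_filter:
  fixes xs :: "real list"
  assumes "sorted xs" "j < length xs"
  shows "xs ! j \<le> a \<longleftrightarrow> j < length (filter (\<lambda>x. x \<le> a) xs)"
  using assms
proof (induction xs arbitrary: j)
  case (Cons x xs)
  show ?case
  proof (cases j)
    case (Suc i)
    show ?thesis
    proof (cases "x \<le> a")
      case False
      then have "filter (\<lambda>x. x \<le> a) xs = []"
        using Cons.prems by (auto simp: filter_empty_conv)
      moreover have "x \<le> xs ! i"
        using Cons.prems Suc by auto
      ultimately show ?thesis
        using False Suc by auto
    qed (use Cons Suc in auto)
  qed (use Cons.prems in \<open>auto simp: filter_empty_conv\<close>)
qed simp

lemma measurable_order_stat [measurable]:
  assumes [measurable]: "\<And>j. j \<in> {1..k} \<Longrightarrow> (\<lambda>\<omega>. u \<omega> j) \<in> borel_measurable N"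
  shows "(\<lambda>\<omega>. order_stat (u \<omega>) k j) \<in> borel_measurable N"
proof (cases "j \<in> {1..k}")
  case True
  have count: "length (filter (\<lambda>x. x \<le> a) (sort xs)) = length (filter (\<lambda>x. x \<le> a) xs)"
    for a :: real and xs
    by (simp add: filter_sort)
  have "length (filter (\<lambda>x. x \<le> a) (map v [1..<Suc k])) = (\<Sum>i\<in>{1..k}. if v i \<le> a then 1 else 0)"
    for v :: "nat \<Rightarrow> real" and a
    by (induction k) (auto simp: atLeastAtMostSuc_conv)
  moreover have "order_stat v k j \<le> a \<longleftrightarrow> j - 1 < length (filter (\<lambda>x. x \<le> a) (map v [1..<Suc k]))" for v a
    using True sorted_nth_le_iff_length_filter[of "sort (map v [1..<Suc k])" "j - 1" a]
    unfolding count by (auto simp add: order_stat_def simp del: upt_Suc)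
  ultimately have iff: "order_stat v k j \<le> a \<longleftrightarrow> j - 1 < (\<Sum>i\<in>{1..k}. if v i \<le> a then 1 else (0::nat))"
    for v a
    by simp
  show ?thesis
    unfolding borel_measurable_iff_le iff by measurable
next
  case False
  then have "j = 0 \<or> k < j" by auto
  then show ?thesis by auto
qed

lemma ex_cell:
  assumes "t \<in> {0<..1}"
  shows "\<exists>j\<in>{0..k}. t \<in> cell u k j"
proof -
  define m where "m = (LEAST m. t \<le> order_stat u k m)"
  have ex: "t \<le> order_stat u k (Suc k)"
    using assms by simp
  have m: "t \<le> order_stat u k m" "m \<le> Suc k"
    unfolding m_def by (rule LeastI[where P="\<lambda>m. t \<le> order_stat u k m", OF ex],
        rule Least_le[where P="\<lambda>m. t \<le> order_stat u k m", OF ex])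
  have "m \<noteq> 0"
    using m(1) assms by (intro notI) simp
  then obtain j where j: "m = Suc j" by (cases m) auto
  have "\<not> t \<le> order_stat u k j"
    using not_less_Least[of j "\<lambda>m. t \<le> order_stat u k m"] j unfolding m_def by simp
  then show ?thesis
    using m j by (intro bexI[of _ j]) (auto simp: cell_def)
qed

lemma cell_unique:
  assumes u: "u \<in> {1..k} \<rightarrow> {0..1}" and "t \<in> cell u k i" "t \<in> cell u k j"
  shows "i = j"
proof (rule ccontr)
  assume "i \<noteq> j"
  then have "Suc i \<le> j \<or> Suc j \<le> i" by auto
  then have "order_stat u k (Suc i) \<le> order_stat u k j \<or> order_stat u k (Suc j) \<le> order_stat u k i"
    using order_stat_mono[OF u] by blast
  then show False
    using assms(2,3) by (auto simp: cell_def)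
qed

lemma split_point_not_inside_cell:
  assumes u: "u \<in> {1..k} \<rightarrow> {0..1}" and "i \<in> {1..k}" "z \<in> cell u k j" "x \<in> cell u k j"
  shows "u i \<notin> {z..<x}"
proof -
  obtain \<pi> where \<pi>: "bij_betw \<pi> {1..k} {1..k}" "\<And>j. j \<in> {1..k} \<Longrightarrow> order_stat u k j = u (\<pi> j)"
    by (rule order_stat_permutation[of k u]) blast
  obtain m where m: "m \<in> {1..k}" "i = \<pi> m"
    using \<pi>(1) assms(2) unfolding bij_betw_def by blast
  consider "m \<le> j" | "Suc j \<le> m" by linarith
  then have "order_stat u k m \<le> order_stat u k j \<or> order_stat u k (Suc j) \<le> order_stat u k m"
    using order_stat_mono[OF u] by blast
  then show ?thesis
    using assms(3,4) \<pi>(2)[OF m(1)] m(2) by (auto simp: cell_def)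
qed

lemma cell_subset:
  assumes "u \<in> {1..k} \<rightarrow> {0..1}"
  shows "cell u k j \<subseteq> {0<..1}"
  using order_stat_mem[OF assms, of j] order_stat_mem[OF assms, of "Suc j"]
  by (auto simp: cell_def)

lemma cell_in_borel [measurable]: "cell u k j \<in> sets borel"
  by (simp add: cell_def)

definition cell_length :: "(nat \<Rightarrow> real) \<Rightarrow> nat \<Rightarrow> nat \<Rightarrow> real" where
  "cell_length u k j = order_stat u k (Suc j) - order_stat u k j"

text \<open>
  An inner cell is delimited by two consecutive order statistics, that is, by two split points with distinct
  indices; sending the cell to this pair is injective. The summand \<open>2\<close> accounts for the first and the
  last cell, which have \<open>0\<close> or \<open>1\<close> as an end point.
\<close>

lemma card_short_cells_le:
  assumes u: "u \<in> {1..k} \<rightarrow> {0..1}"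
  shows "card {j \<in> {0..k}. cell_length u k j \<le> \<delta>}
    \<le> 2 + card {(i, i'). i \<in> {1..k} \<and> i' \<in> {1..k} \<and> i \<noteq> i' \<and> \<bar>u i' - u i\<bar> \<le> \<delta>}"
    (is "_ \<le> 2 + card ?pairs")
proof -
  obtain \<pi> where \<pi>: "bij_betw \<pi> {1..k} {1..k}" "\<And>j. j \<in> {1..k} \<Longrightarrow> order_stat u k j = u (\<pi> j)"
    by (rule order_stat_permutation[of k u]) blast
  let ?S = "{j \<in> {1..<k}. cell_length u k j \<le> \<delta>}"
  have fin: "finite ?pairs"
    by (rule finite_subset[of _ "{1..k} \<times> {1..k}"]) auto
  have inj: "inj_on \<pi> {1..k}"
    using \<pi>(1) by (simp add: bij_betw_def)
  have "card ?S \<le> card ?pairs"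
  proof (rule card_inj_on_le[OF _ _ fin, where f = "\<lambda>j. (\<pi> j, \<pi> (Suc j))"])
    show "inj_on (\<lambda>j. (\<pi> j, \<pi> (Suc j))) ?S"
      using inj by (intro inj_onI) (auto dest: inj_onD)
    show "(\<lambda>j. (\<pi> j, \<pi> (Suc j))) ` ?S \<subseteq> ?pairs"
    proof clarify
      fix j assume j: "j \<in> {1..<k}" "cell_length u k j \<le> \<delta>"
      then have mem: "j \<in> {1..k}" "Suc j \<in> {1..k}" by auto
      then have "\<pi> j \<noteq> \<pi> (Suc j)" "\<pi> j \<in> {1..k}" "\<pi> (Suc j) \<in> {1..k}"
        using inj_onD[OF inj, of j "Suc j"] bij_betwE[OF \<pi>(1)] by auto
      moreover have "\<bar>u (\<pi> (Suc j)) - u (\<pi> j)\<bar> \<le> \<delta>"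
        using j(2) order_stat_mono[OF u, of j "Suc j"] \<pi>(2)[OF mem(1)] \<pi>(2)[OF mem(2)]
        by (simp add: cell_length_def)
      ultimately show "\<pi> j \<in> {1..k} \<and> \<pi> (Suc j) \<in> {1..k} \<and> \<pi> j \<noteq> \<pi> (Suc j) \<and>
          \<bar>u (\<pi> (Suc j)) - u (\<pi> j)\<bar> \<le> \<delta>"
        by simp
    qed
  qed
  moreover have "card {j \<in> {0..k}. cell_length u k j \<le> \<delta>} \<le> card ({0, k} \<union> ?S)"
    by (intro card_mono) auto
  moreover have "card ({0, k} \<union> ?S) \<le> 2 + card ?S"
    by (rule order.trans[OF card_Un_le]) (auto simp: card_insert_if)
  ultimately show ?thesis
    by linarith
qed

section \<open>Independence as integration over separate copies\<close>

text \<open>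
  The joint law of independent variables is the product of their laws, so Tonelli's theorem applies.
  Keeping \<open>M\<close> itself as the space of both integrations lets the inner integral be computed again with the
  random variables of the model.
\<close>

lemma (in prob_space) nn_integral_indep_var:
  assumes indep: "indep_var S Y T Z" and f[measurable]: "f \<in> borel_measurable (S \<Otimes>\<^sub>M T)"
  shows "(\<integral>\<^sup>+\<omega>. f (Y \<omega>, Z \<omega>) \<partial>M) = (\<integral>\<^sup>+\<omega>. \<integral>\<^sup>+\<omega>'. f (Y \<omega>, Z \<omega>') \<partial>M \<partial>M)"
proof -
  have [measurable]: "Y \<in> measurable M S" "Z \<in> measurable M T"
    using indep by (auto dest: indep_var_rv1 indep_var_rv2)
  interpret Y: prob_space "distr M S Y" by (rule prob_space_distr) measurable
  interpret Z: prob_space "distr M T Z" by (rule prob_space_distr) measurable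
  have "(\<integral>\<^sup>+\<omega>. f (Y \<omega>, Z \<omega>) \<partial>M) = (\<integral>\<^sup>+p. f p \<partial>distr M (S \<Otimes>\<^sub>M T) (\<lambda>\<omega>. (Y \<omega>, Z \<omega>)))"
    by (subst nn_integral_distr) auto
  also have "\<dots> = (\<integral>\<^sup>+p. f p \<partial>(distr M S Y \<Otimes>\<^sub>M distr M T Z))"
    using indep by (simp add: indep_var_distribution_eq)
  also have "\<dots> = (\<integral>\<^sup>+y. \<integral>\<^sup>+z. f (y, z) \<partial>distr M T Z \<partial>distr M S Y)"
    by (subst Z.nn_integral_fst[symmetric]) auto
  also have "\<dots> = (\<integral>\<^sup>+\<omega>. \<integral>\<^sup>+\<omega>'. f (Y \<omega>, Z \<omega>') \<partial>M \<partial>M)"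
    using f by (subst nn_integral_distr)
      (auto intro!: nn_integral_cong nn_integral_distr measurable_Pair2[OF f] measurable_space[of Y M S])
  finally show ?thesis .
qed

lemma measurable_fst_component:
  "v \<in> S \<Longrightarrow> (\<lambda>p. fst p v) \<in> borel_measurable (PiM S (\<lambda>_. borel :: real measure) \<Otimes>\<^sub>M N)"
  by (rule measurable_compose[OF measurable_fst measurable_component_singleton])

lemma measurable_snd_component:
  "v \<in> S \<Longrightarrow> (\<lambda>p. snd p v) \<in> borel_measurable (N \<Otimes>\<^sub>M PiM S (\<lambda>_. borel :: real measure))"
  by (rule measurable_compose[OF measurable_snd measurable_component_singleton])

text \<open>
  A consequence of \<open>measurable_card\<close> in which measurability of \<open>Q j\<close> is required only for \<open>j \<in> J\<close>; the
  variables of the model are measurable only for indices in their ranges.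
\<close>

lemma measurable_card_Collect:
  fixes J :: "nat set"
  assumes "\<And>j. j \<in> J \<Longrightarrow> Measurable.pred N (Q j)"
  shows "(\<lambda>\<omega>. card {j\<in>J. Q j \<omega>}) \<in> measurable N (count_space UNIV)"
proof (rule measurable_card)
  fix j
  show "{\<omega> \<in> space N. j \<in> {j\<in>J. Q j \<omega>}} \<in> sets N"
    using assms[of j] by (cases "j \<in> J") (auto simp: pred_def)
qed

context purt_model
begin

definition rv :: "source \<Rightarrow> 'a \<Rightarrow> real" where
  "rv v = (case v of Design i \<Rightarrow> X i | Noise i \<Rightarrow> \<epsilon> i | Split j \<Rightarrow> U j | New_Point \<Rightarrow> X')"

definition sources :: "source set" where
  "sources = Design ` {1..n} \<union> Noise ` {1..n} \<union> Split ` {1..k} \<union> {New_Point}"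

lemma rv_simps [simp]: "rv (Design i) = X i" "rv (Noise i) = \<epsilon> i" "rv (Split j) = U j" "rv New_Point = X'"
  by (simp_all add: rv_def)

lemma indep_rv: "indep_vars (\<lambda>_. borel) rv sources"
  using indep by (simp add: rv_def[abs_def] sources_def)

lemma measurable_rv: "v \<in> sources \<Longrightarrow> rv v \<in> borel_measurable P"
  using indep_rv by (auto simp: indep_vars_def)

lemma measurable_sources [measurable]:
  "i \<in> {1..n} \<Longrightarrow> X i \<in> borel_measurable P"
  "i \<in> {1..n} \<Longrightarrow> \<epsilon> i \<in> borel_measurable P"
  "j \<in> {1..k} \<Longrightarrow> U j \<in> borel_measurable P"
  "X' \<in> borel_measurable P"
  using measurable_rv[of "Design i"] measurable_rv[of "Noise i"] measurable_rv[of "Split j"]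
    measurable_rv[of New_Point] by (auto simp: sources_def)

text \<open>
  The replacement for conditioning. The function \<open>f\<close> may look only at the sources in \<open>A\<close> and in \<open>B\<close>
  respectively; \<open>g\<close> is the same quantity expressed through the variables of the model.
\<close>

lemma nn_integral_decouple:
  assumes AB: "A \<inter> B = {}" "A \<subseteq> sources" "B \<subseteq> sources"
    and [measurable]: "case_prod f \<in> borel_measurable (PiM A (\<lambda>_. borel) \<Otimes>\<^sub>M PiM B (\<lambda>_. borel))"
    and cong: "\<And>\<omega> \<omega>'. f (restrict (\<lambda>v. rv v \<omega>) A) (restrict (\<lambda>v. rv v \<omega>') B) = g \<omega> \<omega>'"
  shows "(\<integral>\<^sup>+\<omega>. g \<omega> \<omega> \<partial>P) = (\<integral>\<^sup>+\<omega>. \<integral>\<^sup>+\<omega>'. g \<omega> \<omega>' \<partial>P \<partial>P)"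
  using nn_integral_indep_var[OF indep_var_restrict[OF indep_rv AB], of "case_prod f"]
  by (simp add: cong)

end

section \<open>Spacings of the split points\<close>

text \<open>
  This makes the sum of the cubed lengths of the cells a double integral of \<open>6(x - z)\<close> over the pairs that
  lie in a common cell. Since \<^term>\<open>ennreal\<close> maps negative numbers to \<open>0\<close>, only the pairs with \<open>z \<le> x\<close>
  count.
\<close>

lemma cube_of_length_eq_nn_integral:
  fixes a b :: real
  assumes "a \<le> b"
  shows "(\<integral>\<^sup>+x. \<integral>\<^sup>+z. ennreal (6 * (x - z)) * indicator {a<..b} x * indicator {a<..b} z \<partial>lborel \<partial>lborel)
    = ennreal ((b - a) ^ 3)"
proof -
  have inner: "(\<integral>\<^sup>+z. ennreal (6 * (x - z)) * indicator {a<..b} x * indicator {a<..b} z \<partial>lborel)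
      = ennreal (3 * (x - a)\<^sup>2) * indicator {a<..b} x" for x
  proof (cases "x \<in> {a<..b}")
    case True
    have "(\<integral>\<^sup>+z. ennreal (6 * (x - z)) * indicator {a<..b} x * indicator {a<..b} z \<partial>lborel)
        = (\<integral>\<^sup>+z. ennreal (6 * (x - z)) * indicator {a..x} z \<partial>lborel)"
    proof (rule nn_integral_cong_AE)
      show "AE z in lborel. ennreal (6 * (x - z)) * indicator {a<..b} x * indicator {a<..b} z
          = ennreal (6 * (x - z)) * indicator {a..x} z"
        using AE_lborel_singleton[of a]
        by eventually_elim (use True in \<open>auto simp: indicator_def ennreal_neg\<close>)
    qed
    also have "\<dots> = ennreal (- 3 * (x - x)\<^sup>2 - (- 3 * (x - a)\<^sup>2))"
      using True
      by (intro nn_integral_FTC_Icc[where F = "\<lambda>z. - 3 * (x - z)\<^sup>2"]) (auto intro!: derivative_eq_intros)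
    finally show ?thesis
      using True by simp
  qed simp
  have "(\<integral>\<^sup>+x. ennreal (3 * (x - a)\<^sup>2) * indicator {a<..b} x \<partial>lborel)
      = (\<integral>\<^sup>+x. ennreal (3 * (x - a)\<^sup>2) * indicator {a..b} x \<partial>lborel)"
  proof (rule nn_integral_cong_AE)
    show "AE x in lborel. ennreal (3 * (x - a)\<^sup>2) * indicator {a<..b} x
        = ennreal (3 * (x - a)\<^sup>2) * indicator {a..b} x"
      using AE_lborel_singleton[of a] by eventually_elim (auto simp: indicator_def)
  qed
  also have "\<dots> = ennreal ((b - a) ^ 3 - (a - a) ^ 3)"
    using assms
    by (intro nn_integral_FTC_Icc[where F = "\<lambda>x. (x - a) ^ 3"])
      (auto intro!: derivative_eq_intros simp: power2_eq_square)
  finally show ?thesis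
    by (simp only: inner) simp
qed

text \<open>
  In terms of \<open>v = 1 - (x - z)\<close> the integrand is \<open>6(v\<^sup>k - v\<^sup>k\<^sup>+\<^sup>1)\<close>, which has an explicit
  antiderivative. Dropping its nonnegative value at \<open>z = 0\<close> gives a bound that is uniform in \<open>x\<close>.
\<close>

lemma nn_integral_gap_times_power_le:
  fixes x :: real
  assumes "x \<in> {0..1}"
  shows "(\<integral>\<^sup>+z. ennreal (6 * (x - z) * (1 - (x - z)) ^ k) * indicator {0..x} z \<partial>lborel)
    \<le> ennreal (6 / ((real k + 1) * (real k + 2)))"
proof -
  define F where "F = (\<lambda>v::real. 6 * (v ^ (k + 1) / (real k + 1) - v ^ (k + 2) / (real k + 2)))"
  have F': "(F has_real_derivative 6 * (v ^ k - v ^ (k + 1))) (at v)" for v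
  proof -
    have "((\<lambda>v. v ^ Suc m / real (Suc m)) has_real_derivative v ^ m) (at v)" for m
      using DERIV_cdivide[OF DERIV_pow[of "Suc m" v], of "real (Suc m)"] by (simp del: of_nat_Suc)
    then have "((\<lambda>v. 6 * (v ^ Suc k / real (Suc k) - v ^ Suc (Suc k) / real (Suc (Suc k))))
        has_real_derivative 6 * (v ^ k - v ^ Suc k)) (at v)"
      by (intro DERIV_cmult DERIV_diff)
    then show ?thesis
      by (simp add: F_def add.commute)
  qed
  have "(\<integral>\<^sup>+z. ennreal (6 * (x - z) * (1 - (x - z)) ^ k) * indicator {0..x} z \<partial>lborel)
      = ennreal (F (1 - x + x) - F (1 - x + 0))"
  proof (intro nn_integral_FTC_Icc[where F = "\<lambda>z. F (1 - x + z)"])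
    fix z
    show "((\<lambda>z. F (1 - x + z)) has_real_derivative 6 * (x - z) * (1 - (x - z)) ^ k) (at z)"
      by (rule DERIV_cong[OF DERIV_chain2[OF F', where g = "\<lambda>z. 1 - x + z"]])
        (auto intro!: derivative_eq_intros simp: algebra_simps)
  qed (use assms in auto)
  also have "\<dots> \<le> ennreal (6 / ((real k + 1) * (real k + 2)))"
  proof (rule ennreal_leI)
    have "(1 - x) / (real k + 2) \<le> 1 / (real k + 1)"
      using assms by (intro frac_le) auto
    then have "0 \<le> 6 * ((1 - x) ^ (k + 1) * (1 / (real k + 1) - (1 - x) / (real k + 2)))"
      using assms by (intro mult_nonneg_nonneg) auto
    also have "\<dots> = F (1 - x + 0)"
      by (simp add: F_def right_diff_distrib mult_ac)
    finally have "0 \<le> F (1 - x + 0)" .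
    moreover have "F (1 - x + x) = 6 / ((real k + 1) * (real k + 2))"
      by (simp add: F_def field_simps)
    ultimately show "F (1 - x + x) - F (1 - x + 0) \<le> 6 / ((real k + 1) * (real k + 2))"
      by simp
  qed
  finally show ?thesis .
qed

context purt_model
begin

lemma emeasure_U:
  assumes "j \<in> {1..k}" and [measurable]: "A \<in> sets borel"
  shows "emeasure P {\<omega> \<in> space P. U j \<omega> \<in> A} = emeasure lborel ({0..1} \<inter> A)"
proof -
  have [measurable]: "U j \<in> borel_measurable P"
    using assms by measurable
  have "emeasure (distr P lborel (U j)) A = emeasure P {\<omega> \<in> space P. U j \<omega> \<in> A}"
    by (subst emeasure_distr) (auto intro!: arg_cong[where f = "emeasure P"])
  then show ?thesis
    using U_uniform[OF assms(1)] by (simp add: divide_ennreal_def)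
qed

lemma AE_U_range: "AE \<omega> in P. (\<lambda>j. U j \<omega>) \<in> {1..k} \<rightarrow> {0..1}"
  unfolding Pi_iff
proof (rule AE_finite_allI)
  fix j assume j: "j \<in> {1..k}"
  then have [measurable]: "U j \<in> borel_measurable P" by measurable
  have "emeasure P {\<omega> \<in> space P. U j \<omega> \<in> {0..1}} = 1"
    using j by (simp add: emeasure_U del: atLeastAtMost_iff)
  then show "AE \<omega> in P. U j \<omega> \<in> {0..1}"
    by (intro AE_I_eq_1) (auto simp del: atLeastAtMost_iff)
qed simp

lemma prob_no_split_between:
  assumes zx: "0 \<le> z" "z \<le> x" "x \<le> 1"
  shows "emeasure P {\<omega> \<in> space P. \<forall>i\<in>{1..k}. U i \<omega> \<notin> {z..<x}} = ennreal ((1 - (x - z)) ^ k)"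
proof (cases "k = 0")
  case True
  then show ?thesis by (simp add: emeasure_space_1)
next
  case False
  let ?S = "Split ` {1..k}"
  have one: "prob (rv (Split i) -` (- {z..<x}) \<inter> space P) = 1 - (x - z)" if i: "i \<in> {1..k}" for i
  proof -
    have [measurable]: "U i \<in> borel_measurable P"
      using i by measurable
    have "emeasure P {\<omega> \<in> space P. U i \<omega> \<in> {z..<x}} = emeasure lborel {z..<x}"
      using zx by (subst emeasure_U[OF i]) (auto simp: Int_absorb1 subset_eq)
    then have "prob {\<omega> \<in> space P. U i \<omega> \<in> {z..<x}} = x - z"
      using zx by (simp add: measure_def)
    moreover have "prob (rv (Split i) -` (- {z..<x}) \<inter> space P)
        = prob (space P - {\<omega> \<in> space P. U i \<omega> \<in> {z..<x}})"
      by (intro arg_cong[where f = prob]) auto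
    ultimately show ?thesis
      by (subst (asm) prob_compl) auto
  qed
  have "prob (\<Inter>v\<in>?S. rv v -` (- {z..<x}) \<inter> space P) = (\<Prod>v\<in>?S. prob (rv v -` (- {z..<x}) \<inter> space P))"
    using False by (intro indep_varsD[OF indep_rv]) (auto simp: sources_def)
  also have "\<dots> = (\<Prod>v\<in>?S. 1 - (x - z))"
    by (intro prod.cong) (auto simp: one[simplified])
  also have "\<dots> = (1 - (x - z)) ^ k"
    by (simp add: card_image inj_on_def)
  also have "(\<Inter>v\<in>?S. rv v -` (- {z..<x}) \<inter> space P)
      = {\<omega> \<in> space P. \<forall>i\<in>{1..k}. U i \<omega> \<notin> {z..<x}}"
    using False by (auto simp: Suc_le_eq)
  finally show ?thesis
    by (simp add: emeasure_eq_measure)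
qed

text \<open>
  After the cubes are written as double integrals, Tonelli's theorem moves the expectation inside; two points
  \<open>z \<le> x\<close> can share a cell only if no split point falls into \<open>[z, x)\<close>, which has probability
  \<open>(1 - (x - z))\<^sup>k\<close>.
\<close>

lemma expectation_sum_cubed_lengths_le:
  "(\<integral>\<^sup>+\<omega>. (\<Sum>j=0..k. ennreal (cell_length (\<lambda>i. U i \<omega>) k j ^ 3)) \<partial>P)
    \<le> ennreal (6 / ((real k + 1) * (real k + 2)))"
proof -
  interpret pair_sigma_finite P lborel ..
  define free where "free \<omega> z x \<longleftrightarrow> (\<forall>i\<in>{1..k}. U i \<omega> \<notin> {z..<x})" for \<omega> z x
  define g :: "'a \<Rightarrow> real \<Rightarrow> real \<Rightarrow> ennreal" where
    "g \<omega> x z = ennreal (6 * (x - z)) * indicator {0<..1} x * indicator {0<..1} z * (if free \<omega> z x then 1 else 0)" for \<omega> x z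
  have [measurable]: "(\<lambda>(\<omega>, x, z). g \<omega> x z) \<in> borel_measurable (P \<Otimes>\<^sub>M borel \<Otimes>\<^sub>M borel)"
    unfolding g_def free_def atLeastLessThan_iff by measurable
  have "(\<integral>\<^sup>+\<omega>. (\<Sum>j=0..k. ennreal (cell_length (\<lambda>i. U i \<omega>) k j ^ 3)) \<partial>P)
      \<le> (\<integral>\<^sup>+\<omega>. \<integral>\<^sup>+x. \<integral>\<^sup>+z. g \<omega> x z \<partial>lborel \<partial>lborel \<partial>P)"
  proof (rule nn_integral_mono_AE, rule AE_mp[OF AE_U_range], intro AE_I2 impI)
    fix \<omega>
    assume u: "(\<lambda>j. U j \<omega>) \<in> {1..k} \<rightarrow> {0..1}"
    let ?A = "cell (\<lambda>i. U i \<omega>) k"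
    have "(\<Sum>j=0..k. ennreal (cell_length (\<lambda>i. U i \<omega>) k j ^ 3))
        = (\<Sum>j=0..k. \<integral>\<^sup>+x. \<integral>\<^sup>+z. ennreal (6 * (x - z)) * indicator (?A j) x * indicator (?A j) z \<partial>lborel \<partial>lborel)"
      unfolding cell_def cell_length_def
      by (intro sum.cong refl cube_of_length_eq_nn_integral[symmetric] order_stat_mono u) auto
    also have "\<dots> = (\<integral>\<^sup>+x. (\<Sum>j=0..k. \<integral>\<^sup>+z. ennreal (6 * (x - z)) * indicator (?A j) x * indicator (?A j) z \<partial>lborel) \<partial>lborel)"
      by (rule nn_integral_sum[symmetric]) measurable
    also have "\<dots> = (\<integral>\<^sup>+x. \<integral>\<^sup>+z. (\<Sum>j=0..k. ennreal (6 * (x - z)) * indicator (?A j) x * indicator (?A j) z) \<partial>lborel \<partial>lborel)"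
      by (intro nn_integral_cong nn_integral_sum[symmetric]) measurable
    also have "\<dots> \<le> (\<integral>\<^sup>+x. \<integral>\<^sup>+z. g \<omega> x z \<partial>lborel \<partial>lborel)"
    proof (intro nn_integral_mono)
      fix x z :: real
      \<comment> \<open>The cells are disjoint, so at most one summand is nonzero.\<close>
      show "(\<Sum>j=0..k. ennreal (6 * (x - z)) * indicator (?A j) x * indicator (?A j) z) \<le> g \<omega> x z"
      proof (cases "\<exists>j\<in>{0..k}. x \<in> ?A j \<and> z \<in> ?A j")
        case True
        then obtain j where j: "j \<in> {0..k}" "x \<in> ?A j" "z \<in> ?A j" by blast
        have "x \<in> ?A i \<longleftrightarrow> i = j" for i
          using j(2) cell_unique[OF u _ j(2)] by blast
        then have "(\<Sum>j=0..k. ennreal (6 * (x - z)) * indicator (?A j) x * indicator (?A j) z)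
            = ennreal (6 * (x - z))"
          using j by (simp add: indicator_def if_distrib if_distribR cong: if_cong)
        moreover have "free \<omega> z x"
          unfolding free_def using split_point_not_inside_cell[OF u] j by blast
        moreover have "x \<in> {0<..1}" "z \<in> {0<..1}"
          using cell_subset[OF u] j by blast+
        ultimately show ?thesis
          by (simp add: g_def)
      next
        case False
        then have "(\<Sum>j=0..k. ennreal (6 * (x - z)) * indicator (?A j) x * indicator (?A j) z) = 0"
          by (intro sum.neutral) (auto simp: indicator_def)
        then show ?thesis by (simp only: zero_le)
      qed
    qed
    finally show "(\<Sum>j=0..k. ennreal (cell_length (\<lambda>i. U i \<omega>) k j ^ 3))
        \<le> (\<integral>\<^sup>+x. \<integral>\<^sup>+z. g \<omega> x z \<partial>lborel \<partial>lborel)" .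
  qed
  also have "\<dots> = (\<integral>\<^sup>+x. \<integral>\<^sup>+\<omega>. \<integral>\<^sup>+z. g \<omega> x z \<partial>lborel \<partial>P \<partial>lborel)"
    by (rule Fubini'[symmetric]) (unfold g_def free_def atLeastLessThan_iff, measurable)
  also have "\<dots> = (\<integral>\<^sup>+x. \<integral>\<^sup>+z. \<integral>\<^sup>+\<omega>. g \<omega> x z \<partial>P \<partial>lborel \<partial>lborel)"
    by (intro nn_integral_cong Fubini'[symmetric]) (unfold g_def free_def atLeastLessThan_iff, measurable)
  also have "\<dots> \<le> (\<integral>\<^sup>+x. ennreal (6 / ((real k + 1) * (real k + 2))) * indicator {0..1::real} x \<partial>lborel)"
  proof (intro nn_integral_mono)
    fix x :: real
    show "(\<integral>\<^sup>+z. \<integral>\<^sup>+\<omega>. g \<omega> x z \<partial>P \<partial>lborel) \<le> ennreal (6 / ((real k + 1) * (real k + 2))) * indicator {0..1} x"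
    proof (cases "x \<in> {0<..1}")
      case True
      have "(\<integral>\<^sup>+\<omega>. g \<omega> x z \<partial>P) \<le> ennreal (6 * (x - z) * (1 - (x - z)) ^ k) * indicator {0..x} z" for z
      proof (cases "z \<in> {0<..x}")
        case z: True
        have meas: "{\<omega> \<in> space P. free \<omega> z x} \<in> sets P"
          unfolding free_def atLeastLessThan_iff by measurable
        have "(\<integral>\<^sup>+\<omega>. g \<omega> x z \<partial>P) = (\<integral>\<^sup>+\<omega>. ennreal (6 * (x - z)) * indicator {\<omega> \<in> space P. free \<omega> z x} \<omega> \<partial>P)"
          using True z by (intro nn_integral_cong) (auto simp: g_def)
        also have "\<dots> = ennreal (6 * (x - z)) * emeasure P {\<omega> \<in> space P. free \<omega> z x}"
          using meas by (rule nn_integral_cmult_indicator)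
        also have "emeasure P {\<omega> \<in> space P. free \<omega> z x} = ennreal ((1 - (x - z)) ^ k)"
          unfolding free_def using True z by (intro prob_no_split_between) auto
        finally show ?thesis
          using True z by (simp add: ennreal_mult)
      next
        case False
        then have "g \<omega> x z = 0" for \<omega>
          using True by (auto simp: g_def ennreal_neg indicator_def)
        then show ?thesis by simp
      qed
      then have "(\<integral>\<^sup>+z. \<integral>\<^sup>+\<omega>. g \<omega> x z \<partial>P \<partial>lborel)
          \<le> (\<integral>\<^sup>+z. ennreal (6 * (x - z) * (1 - (x - z)) ^ k) * indicator {0..x} z \<partial>lborel)"
        by (intro nn_integral_mono)
      also have "\<dots> \<le> ennreal (6 / ((real k + 1) * (real k + 2)))"
        using True by (intro nn_integral_gap_times_power_le) auto
      finally show ?thesis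
        using True by simp
    qed (auto simp: g_def)
  qed
  also have "\<dots> = ennreal (6 / ((real k + 1) * (real k + 2)))"
    by (subst nn_integral_cmult_indicator) auto
  finally show ?thesis .
qed

lemma prob_splits_close_le:
  assumes ij: "i \<in> {1..k}" "j \<in> {1..k}" "i \<noteq> j" and "0 \<le> \<delta>"
  shows "emeasure P {\<omega> \<in> space P. \<bar>U j \<omega> - U i \<omega>\<bar> \<le> \<delta>} \<le> ennreal (2 * \<delta>)"
proof -
  have [measurable]: "U i \<in> borel_measurable P" "U j \<in> borel_measurable P"
    using ij by measurable
  have meas: "{\<omega> \<in> space P. \<bar>U j \<omega> - c\<bar> \<le> \<delta>} \<in> sets P" "{\<omega> \<in> space P. \<bar>U j \<omega> - U i \<omega>\<bar> \<le> \<delta>} \<in> sets P" for c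
    by measurable
  have "emeasure P {\<omega> \<in> space P. \<bar>U j \<omega> - U i \<omega>\<bar> \<le> \<delta>}
      = (\<integral>\<^sup>+\<omega>. (if \<bar>U j \<omega> - U i \<omega>\<bar> \<le> \<delta> then 1 else 0) \<partial>P)"
    unfolding nn_integral_indicator[OF meas(2), symmetric] by (intro nn_integral_cong) (auto simp: indicator_def)
  also have "\<dots> = (\<integral>\<^sup>+\<omega>. \<integral>\<^sup>+\<omega>'. (if \<bar>U j \<omega>' - U i \<omega>\<bar> \<le> \<delta> then 1 else 0) \<partial>P \<partial>P)"
    by (rule nn_integral_decouple[of "{Split i}" "{Split j}"
          "\<lambda>v w. if \<bar>w (Split j) - v (Split i)\<bar> \<le> \<delta> then 1 else 0"])
      (use ij in \<open>auto simp: sources_def\<close>)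
  also have "\<dots> \<le> (\<integral>\<^sup>+\<omega>. ennreal (2 * \<delta>) \<partial>P)"
  proof (rule nn_integral_mono)
    fix \<omega>
    have "(\<integral>\<^sup>+\<omega>'. (if \<bar>U j \<omega>' - U i \<omega>\<bar> \<le> \<delta> then 1 else 0) \<partial>P)
        = emeasure P {\<omega>' \<in> space P. \<bar>U j \<omega>' - U i \<omega>\<bar> \<le> \<delta>}"
      unfolding nn_integral_indicator[OF meas(1), symmetric] by (intro nn_integral_cong) (auto simp: indicator_def)
    also have "\<dots> = emeasure P {\<omega>' \<in> space P. U j \<omega>' \<in> {U i \<omega> - \<delta>..U i \<omega> + \<delta>}}"
      by (intro arg_cong[where f = "emeasure P"]) auto
    also have "\<dots> \<le> emeasure lborel {U i \<omega> - \<delta>..U i \<omega> + \<delta>}"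
      using ij by (subst emeasure_U) (auto intro!: emeasure_mono)
    also have "\<dots> = ennreal (2 * \<delta>)"
      using \<open>0 \<le> \<delta>\<close> by simp
    finally show "(\<integral>\<^sup>+\<omega>'. (if \<bar>U j \<omega>' - U i \<omega>\<bar> \<le> \<delta> then 1 else 0) \<partial>P) \<le> ennreal (2 * \<delta>)" .
  qed
  also have "\<dots> = ennreal (2 * \<delta>)"
    by (simp add: emeasure_space_1)
  finally show ?thesis .
qed

text \<open>
  There are at most \<open>k\<^sup>2\<close> ordered pairs of split points, each of which is \<open>\<delta>\<close>-close with probability at most
  \<open>2 \<delta>\<close>.
\<close>

lemma expectation_number_of_short_cells_le:
  assumes "0 \<le> \<delta>"
  shows "(\<integral>\<^sup>+\<omega>. of_nat (card {j \<in> {0..k}. cell_length (\<lambda>i. U i \<omega>) k j \<le> \<delta>}) \<partial>P)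
    \<le> ennreal (2 + 2 * (real k)\<^sup>2 * \<delta>)"
proof -
  let ?I = "{1..k} \<times> {1..k}"
  define close :: "nat \<times> nat \<Rightarrow> 'a \<Rightarrow> ennreal" where
    "close = (\<lambda>(i, j). indicator {\<omega> \<in> space P. i \<noteq> j \<and> \<bar>U j \<omega> - U i \<omega>\<bar> \<le> \<delta>})"
  have meas: "{\<omega> \<in> space P. i \<noteq> j \<and> \<bar>U j \<omega> - U i \<omega>\<bar> \<le> \<delta>} \<in> sets P" if "(i, j) \<in> ?I" for i j
  proof -
    have [measurable]: "U i \<in> borel_measurable P" "U j \<in> borel_measurable P"
      using that measurable_sources(3)[of i] measurable_sources(3)[of j] by simp_all
    show ?thesis by measurable
  qed
  have close_meas: "close p \<in> borel_measurable P" if "p \<in> ?I" for p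
    unfolding close_def case_prod_beta
    by (rule borel_measurable_indicator, rule meas) (use that in simp)
  have "(\<integral>\<^sup>+\<omega>. of_nat (card {j \<in> {0..k}. cell_length (\<lambda>i. U i \<omega>) k j \<le> \<delta>}) \<partial>P)
      \<le> (\<integral>\<^sup>+\<omega>. 2 + (\<Sum>p\<in>?I. close p \<omega>) \<partial>P)"
  proof (rule nn_integral_mono_AE, rule AE_mp[OF AE_U_range], intro AE_I2 impI)
    fix \<omega> assume \<omega>: "\<omega> \<in> space P" and u: "(\<lambda>j. U j \<omega>) \<in> {1..k} \<rightarrow> {0..1}"
    let ?pairs = "{(i, i'). i \<in> {1..k} \<and> i' \<in> {1..k} \<and> i \<noteq> i' \<and> \<bar>U i' \<omega> - U i \<omega>\<bar> \<le> \<delta>}"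
    have "of_nat (card {j \<in> {0..k}. cell_length (\<lambda>i. U i \<omega>) k j \<le> \<delta>}) \<le> (of_nat (2 + card ?pairs) :: ennreal)"
      by (intro of_nat_mono card_short_cells_le u)
    also have "card ?pairs = (\<Sum>p\<in>?pairs. 1)"
      by simp
    also have "\<dots> = (\<Sum>p\<in>?I. if p \<in> ?pairs then 1 else 0)"
      by (rule sum.mono_neutral_cong_left) auto
    also have "of_nat (2 + \<dots>) = 2 + (\<Sum>p\<in>?I. of_nat (if p \<in> ?pairs then 1 else 0) :: ennreal)"
      by simp
    also have "(\<Sum>p\<in>?I. of_nat (if p \<in> ?pairs then 1 else 0)) = (\<Sum>p\<in>?I. close p \<omega>)"
      using \<omega> by (intro sum.cong refl) (auto simp: close_def indicator_def)
    finally show "of_nat (card {j \<in> {0..k}. cell_length (\<lambda>i. U i \<omega>) k j \<le> \<delta>}) \<le> 2 + (\<Sum>p\<in>?I. close p \<omega>)" .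
  qed
  also have "\<dots> = 2 + (\<integral>\<^sup>+\<omega>. (\<Sum>p\<in>?I. close p \<omega>) \<partial>P)"
    by (subst nn_integral_add) (auto simp: emeasure_space_1 intro!: borel_measurable_sum close_meas)
  also have "(\<integral>\<^sup>+\<omega>. (\<Sum>p\<in>?I. close p \<omega>) \<partial>P) = (\<Sum>p\<in>?I. \<integral>\<^sup>+\<omega>. close p \<omega> \<partial>P)"
    by (intro nn_integral_sum close_meas)
  also have "\<dots> \<le> (\<Sum>p\<in>?I. ennreal (2 * \<delta>))"
  proof (rule sum_mono, clarify)
    fix i j assume ij: "i \<in> {1..k}" "j \<in> {1..k}"
    have "(\<integral>\<^sup>+\<omega>. close (i, j) \<omega> \<partial>P) = emeasure P {\<omega> \<in> space P. i \<noteq> j \<and> \<bar>U j \<omega> - U i \<omega>\<bar> \<le> \<delta>}"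
      using meas ij by (simp add: close_def)
    also have "\<dots> \<le> ennreal (2 * \<delta>)"
      using prob_splits_close_le[OF ij _ \<open>0 \<le> \<delta>\<close>] by (cases "i = j") auto
    finally show "(\<integral>\<^sup>+\<omega>. close (i, j) \<omega> \<partial>P) \<le> ennreal (2 * \<delta>)" .
  qed
  also have "\<dots> = ennreal (2 * (real k)\<^sup>2 * \<delta>)"
    using \<open>0 \<le> \<delta>\<close>
    by (simp add: ennreal_of_nat_eq_real_of_nat power2_eq_square flip: ennreal_mult)
  also have "2 + ennreal (2 * (real k)\<^sup>2 * \<delta>) = ennreal (2 + 2 * (real k)\<^sup>2 * \<delta>)"
    using \<open>0 \<le> \<delta>\<close> by (subst ennreal_plus) auto
  finally show ?thesis
    by (simp add: add_mono)
qed

end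

section \<open>Inverse moments of the number of design points in a cell\<close>

text \<open>
  The absorption identity \<open>(j + 1) (n + 1 choose j + 1) = (n + 1) (n choose j)\<close>, summed over \<open>j\<close>.
  It trades a factor \<open>p\<close> for one more trial and thereby computes inverse moments.
\<close>

lemma binomial_size_bias:
  fixes f :: "nat \<Rightarrow> real"
  assumes p: "p \<in> {0..1}"
  shows "real (Suc n) * p * measure_pmf.expectation (binomial_pmf n p) (\<lambda>k. f (Suc k))
    = measure_pmf.expectation (binomial_pmf (Suc n) p) (\<lambda>k. real k * f k)"
proof -
  have *: "real (Suc n choose Suc k) * real (Suc k) = real (Suc n) * real (n choose k)" for k
    using Suc_times_binomial[of k n] by (metis mult.commute of_nat_mult)
  have "measure_pmf.expectation (binomial_pmf (Suc n) p) (\<lambda>k. real k * f k)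
      = (\<Sum>k\<le>n. (real (Suc n choose Suc k) * real (Suc k)) * p ^ Suc k * (1 - p) ^ (n - k) * f (Suc k))"
    unfolding expectation_binomial_pmf'[OF p] sum.atMost_Suc_shift
    by (auto intro!: sum.cong simp del: of_nat_Suc binomial_Suc_Suc)
  also have "\<dots> = real (Suc n) * p * measure_pmf.expectation (binomial_pmf n p) (\<lambda>k. f (Suc k))"
    unfolding expectation_binomial_pmf'[OF p] sum_distrib_left *
    by (intro sum.cong) (auto simp del: of_nat_Suc)
  finally show ?thesis ..
qed

text \<open>
  Size bias with \<open>f(j) = 1/j\<close>: the right-hand side is then the probability of a positive count.
\<close>

lemma binomial_inverse_moment_le:
  assumes p: "p \<in> {0..1}"
  shows "real (Suc n) * p * measure_pmf.expectation (binomial_pmf n p) (\<lambda>k. 1 / (real k + 1)) \<le> 1"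
proof -
  have "real (Suc n) * p * measure_pmf.expectation (binomial_pmf n p) (\<lambda>k. 1 / (real k + 1))
      = measure_pmf.expectation (binomial_pmf (Suc n) p) (\<lambda>k. real k * (1 / real k))"
    using binomial_size_bias[OF p, of n "\<lambda>k. 1 / real k"] by (simp add: add.commute)
  also have "\<dots> \<le> measure_pmf.expectation (binomial_pmf (Suc n) p) (\<lambda>_. 1)"
    using p by (intro integral_mono) auto
  finally show ?thesis by simp
qed

text \<open>
  Size bias with \<open>f(j) = 1/(j (j + 1))\<close> leads back to the first inverse moment for \<open>n + 1\<close> trials.
\<close>

lemma binomial_second_inverse_moment_le:
  assumes p: "p \<in> {0..1}"
  shows "real (Suc n) * real (Suc (Suc n)) * p\<^sup>2 *
    measure_pmf.expectation (binomial_pmf n p) (\<lambda>k. 1 / ((real k + 1) * (real k + 2))) \<le> 1"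
    (is "_ * ?E \<le> 1")
proof -
  have "real (Suc n) * p * ?E
      = measure_pmf.expectation (binomial_pmf (Suc n) p) (\<lambda>k. real k * (1 / (real k * (real k + 1))))"
    using binomial_size_bias[OF p, of n "\<lambda>k. 1 / (real k * (real k + 1))"] by (simp add: add_ac)
  also have "\<dots> \<le> measure_pmf.expectation (binomial_pmf (Suc n) p) (\<lambda>k. 1 / (real k + 1))"
    using p by (intro integral_mono) auto
  finally have "(real (Suc (Suc n)) * p) * (real (Suc n) * p * ?E)
      \<le> (real (Suc (Suc n)) * p) * measure_pmf.expectation (binomial_pmf (Suc n) p) (\<lambda>k. 1 / (real k + 1))"
    using p by (intro mult_left_mono) auto
  also have "\<dots> \<le> 1"
    by (rule binomial_inverse_moment_le[OF p])
  finally show ?thesis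
    by (simp add: power2_eq_square mult_ac)
qed

text \<open>
  Bounds the part of the squared error in a cell that depends on its number \<open>N\<close> of design points. Having
  \<open>N + 1\<close> and \<open>(N + 1)(N + 2)\<close> as denominators covers empty cells as well and suits the size-bias identity.
\<close>

definition occupancy_loss :: "real \<Rightarrow> real \<Rightarrow> nat \<Rightarrow> real" where
  "occupancy_loss v K N = v / (real N + 1) + K / ((real N + 1) * (real N + 2))"

text \<open>
  The first inverse moment yields \<open>v/n\<close> with no loss in the constant. The second one is at most \<open>1/(n p)\<close>
  and at most \<open>1/(n p)\<^sup>2\<close>; the former bound serves for short cells and the latter for the others, where
  \<open>p \<ge> m \<delta>\<close>.
\<close>

lemma expected_occupancy_loss_le:
  assumes p: "p \<in> {0..1}" and n: "1 \<le> n" and "0 \<le> v" "0 \<le> K"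
    and l: "m * l \<le> p" and "0 < m" "0 < \<delta>"
  shows "p * measure_pmf.expectation (binomial_pmf n p) (occupancy_loss v K)
    \<le> v / n + K / n * (of_bool (l \<le> \<delta>) + 1 / (n * m * \<delta>))"
proof -
  let ?E = "measure_pmf.expectation (binomial_pmf n p)"
  let ?E1 = "?E (\<lambda>k. 1 / (real k + 1))" and ?E2 = "?E (\<lambda>k. 1 / ((real k + 1) * (real k + 2)))"
  have n0: "real n > 0" using n by simp
  have E1: "p * ?E1 \<le> 1 / n"
  proof -
    have "real n * (p * ?E1) \<le> real (Suc n) * (p * ?E1)"
      using p by (intro mult_right_mono mult_nonneg_nonneg integral_nonneg_AE) auto
    also have "\<dots> \<le> 1"
      using binomial_inverse_moment_le[OF p, of n] by (simp add: mult_ac)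
    finally show ?thesis
      using n0 by (simp add: field_simps)
  qed
  have E2_nonneg: "0 \<le> ?E2"
    by (intro integral_nonneg_AE) auto
  have E2: "p * ?E2 \<le> 1 / n"
  proof -
    have "?E2 \<le> ?E1"
    proof (intro integral_mono)
      fix k :: nat
      have "(real k + 1) * 1 \<le> (real k + 1) * (real k + 2)"
        by (intro mult_left_mono) auto
      then show "1 / ((real k + 1) * (real k + 2)) \<le> 1 / (real k + 1)"
        by (intro divide_left_mono) auto
    qed (use p in auto)
    then have "p * ?E2 \<le> p * ?E1"
      using p by (intro mult_left_mono) auto
    then show ?thesis using E1 by linarith
  qed
  have E2': "p * ?E2 \<le> 1 / n * (of_bool (l \<le> \<delta>) + 1 / (n * m * \<delta>))"
  proof (cases "l \<le> \<delta>")
    case True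
    have "0 \<le> 1 / n * (1 / (n * m * \<delta>))"
      using assms by simp
    then show ?thesis using E2 True by (simp add: distrib_left del: times_divide_eq_left times_divide_eq_right)
  next
    case False
    then have "m * \<delta> \<le> p"
      using l \<open>0 < m\<close> mult_left_mono[of \<delta> l m] by linarith
    moreover have "0 < m * \<delta>" using assms by simp
    ultimately have "m * \<delta> \<le> p" "0 < m * \<delta>" "0 < p" by auto
    then have "n * (n * (m * \<delta>)) * (p * ?E2) \<le> n * (n * p) * (p * ?E2)"
      using E2_nonneg by (intro mult_right_mono mult_left_mono) auto
    also have "\<dots> = (real n * real n) * (p\<^sup>2 * ?E2)"
      by (simp add: power2_eq_square)
    also have "\<dots> \<le> (real (Suc n) * real (Suc (Suc n))) * (p\<^sup>2 * ?E2)"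
      using E2_nonneg by (intro mult_right_mono mult_mono) auto
    also have "\<dots> \<le> 1"
      using binomial_second_inverse_moment_le[OF p, of n] by (simp add: mult_ac)
    finally show ?thesis
      using False n0 assms by (simp add: field_simps)
  qed
  have "?E (occupancy_loss v K) = v * ?E1 + K * ?E2"
  proof -
    have "occupancy_loss v K = (\<lambda>k. v * (1 / (real k + 1)) + K * (1 / ((real k + 1) * (real k + 2))))"
      by (simp add: occupancy_loss_def fun_eq_iff)
    then show ?thesis
      using p by (simp del: times_divide_eq_right)
  qed
  then have "p * ?E (occupancy_loss v K) = v * (p * ?E1) + K * (p * ?E2)"
    by (simp add: algebra_simps)
  also have "\<dots> \<le> v * (1 / n) + K * (1 / n * (of_bool (l \<le> \<delta>) + 1 / (n * m * \<delta>)))"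
    using E1 E2' assms by (intro add_mono mult_left_mono)
  finally show ?thesis by simp
qed

text \<open>
  The correction term is what \<open>1/N - 1/(N + 1) = 1/(N (N + 1))\<close> costs; \<open>N + 2 \<le> 3 N\<close> explains the constant
  \<open>3\<close>.
\<close>

lemma inverse_le_occupancy:
  assumes "1 \<le> N"
  shows "1 / real N \<le> 1 / (real N + 1) + 3 / ((real N + 1) * (real N + 2))"
proof -
  have "1 / (real N + 1) + 3 / ((real N + 1) * (real N + 2)) - 1 / real N
      = (2 * real N - 2) / (real N * ((real N + 1) * (real N + 2)))"
    using assms by (simp add: divide_simps) (simp add: algebra_simps)
  moreover have "0 \<le> (2 * real N - 2) / (real N * ((real N + 1) * (real N + 2)))"
    using assms by (intro divide_nonneg_nonneg mult_nonneg_nonneg) auto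
  ultimately show ?thesis by linarith
qed

context purt_model
begin

lemma emeasure_X_eq_emeasure_X':
  assumes "i \<in> {1..n}" and A: "A \<in> sets borel"
  shows "emeasure P {\<omega> \<in> space P. X i \<omega> \<in> A} = emeasure P {\<omega> \<in> space P. X' \<omega> \<in> A}"
proof -
  have [measurable]: "X i \<in> borel_measurable P"
    using assms by measurable
  have "emeasure (distr P lborel (X i)) A = emeasure (distr P lborel X') A"
    using distributed_distr_eq_density[OF X_density[OF assms(1)]] distributed_distr_eq_density[OF X'_density]
    by simp
  then show ?thesis
    using A by (simp add: emeasure_distr vimage_def Int_def conj_commute)
qed

text \<open>
  The number of design points in \<open>A\<close> is binomial. Induction over the index set adds one independent Bernoulli
  trial at a time, which is how \<^term>\<open>binomial_pmf\<close> unfolds.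
\<close>

lemma nn_integral_cell_count:
  assumes J: "finite J" "J \<subseteq> {1..n}" and A[measurable]: "A \<in> sets borel"
  shows "(\<integral>\<^sup>+\<omega>. f (card {i\<in>J. X i \<omega> \<in> A}) \<partial>P)
    = (\<integral>\<^sup>+N. f N \<partial>binomial_pmf (card J) (prob {\<omega> \<in> space P. X' \<omega> \<in> A}))"
  using J
proof (induction J arbitrary: f rule: finite_induct)
  case empty
  then show ?case
    by (simp add: binomial_pmf_0 emeasure_space_1)
next
  case (insert i J)
  let ?p = "prob {\<omega> \<in> space P. X' \<omega> \<in> A}"
  let ?N = "\<lambda>\<omega>. card {i\<in>J. X i \<omega> \<in> A}"
  have p: "?p \<in> {0..1}" by simp
  have [measurable]: "X j \<in> borel_measurable P" if "j \<in> insert i J" for j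
    using insert.prems that by (intro measurable_sources) auto
  have count: "card {j\<in>insert i J. X j \<omega> \<in> A} = of_bool (X i \<omega> \<in> A) + ?N \<omega>" for \<omega>
  proof -
    have "{j\<in>insert i J. X j \<omega> \<in> A} = (if X i \<omega> \<in> A then insert i {j\<in>J. X j \<omega> \<in> A} else {j\<in>J. X j \<omega> \<in> A})"
      by auto
    then show ?thesis using insert.hyps by simp
  qed
  let ?B = "Design ` J"
  let ?N2 = "PiM {Design i} (\<lambda>_. borel :: real measure) \<Otimes>\<^sub>M PiM ?B (\<lambda>_. borel :: real measure)"
  have [measurable]: "(\<lambda>p. fst p (Design i)) \<in> borel_measurable ?N2"
    by (intro measurable_fst_component) simp
  have [measurable]: "(\<lambda>p. card {j\<in>J. snd p (Design j) \<in> A}) \<in> measurable ?N2 (count_space UNIV)"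
    by (intro measurable_card_Collect pred_sets2[OF A measurable_snd_component]) auto
  have f_meas: "case_prod (\<lambda>v w. f (of_bool (v (Design i) \<in> A) + card {j\<in>J. w (Design j) \<in> A}))
      \<in> borel_measurable ?N2"
    unfolding case_prod_beta of_bool_def by measurable
  have "(\<integral>\<^sup>+\<omega>. f (card {j\<in>insert i J. X j \<omega> \<in> A}) \<partial>P)
      = (\<integral>\<^sup>+\<omega>. f (of_bool (X i \<omega> \<in> A) + ?N \<omega>) \<partial>P)"
    by (simp only: count)
  also have "\<dots> = (\<integral>\<^sup>+\<omega>. \<integral>\<^sup>+\<omega>'. f (of_bool (X i \<omega> \<in> A) + ?N \<omega>') \<partial>P \<partial>P)"
    by (rule nn_integral_decouple[OF _ _ _ f_meas])
      (use insert in \<open>auto simp: sources_def restrict_def cong: conj_cong\<close>)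
  also have "\<dots> = (\<integral>\<^sup>+\<omega>. \<integral>\<^sup>+N. f (of_bool (X i \<omega> \<in> A) + N) \<partial>binomial_pmf (card J) ?p \<partial>P)"
    using insert.prems by (subst insert.IH) auto
  also have "\<dots> = (\<integral>\<^sup>+\<omega>. (\<integral>\<^sup>+N. f (1 + N) \<partial>binomial_pmf (card J) ?p) * indicator {\<omega> \<in> space P. X i \<omega> \<in> A} \<omega>
      + (\<integral>\<^sup>+N. f N \<partial>binomial_pmf (card J) ?p) * indicator {\<omega> \<in> space P. X i \<omega> \<in> - A} \<omega> \<partial>P)"
    by (intro nn_integral_cong) (auto simp: indicator_def)
  also have "\<dots> = (\<integral>\<^sup>+N. f (1 + N) \<partial>binomial_pmf (card J) ?p) * emeasure P {\<omega> \<in> space P. X i \<omega> \<in> A}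
      + (\<integral>\<^sup>+N. f N \<partial>binomial_pmf (card J) ?p) * emeasure P {\<omega> \<in> space P. X i \<omega> \<in> - A}"
    by (subst nn_integral_add) (auto simp: nn_integral_cmult_indicator)
  also have "emeasure P {\<omega> \<in> space P. X i \<omega> \<in> A} = ennreal ?p"
    using insert.prems A by (subst emeasure_X_eq_emeasure_X') (auto simp: emeasure_eq_measure)
  also have "emeasure P {\<omega> \<in> space P. X i \<omega> \<in> - A} = ennreal (1 - ?p)"
  proof -
    have "emeasure P {\<omega> \<in> space P. X i \<omega> \<in> - A} = emeasure P {\<omega> \<in> space P. X' \<omega> \<in> - A}"
      using insert.prems A by (intro emeasure_X_eq_emeasure_X') auto
    also have "{\<omega> \<in> space P. X' \<omega> \<in> - A} = space P - {\<omega> \<in> space P. X' \<omega> \<in> A}"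
      by auto
    also have "emeasure P \<dots> = ennreal (1 - ?p)"
      by (subst emeasure_eq_measure, subst prob_compl) auto
    finally show ?thesis .
  qed
  also have "(\<integral>\<^sup>+N. f (1 + N) \<partial>binomial_pmf (card J) ?p) * ennreal ?p
      + (\<integral>\<^sup>+N. f N \<partial>binomial_pmf (card J) ?p) * ennreal (1 - ?p)
      = (\<integral>\<^sup>+N. f N \<partial>binomial_pmf (card (insert i J)) ?p)"
    using insert.hyps p by (simp add: binomial_pmf_Suc)
  finally show ?case .
qed

end

section \<open>Measurability of the estimator\<close>

text \<open>
  A form in which the index sets of the sums no longer depend on the design, so that measurability is visible.
\<close>

lemma cell_mean_eq_quotient_of_sums:
  "cell_mean n x y A = (\<Sum>i\<in>{1..n}. if x i \<in> A then y i else 0) / (\<Sum>i\<in>{1..n}. if x i \<in> A then 1 else 0)"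
proof -
  have "{i. i \<in> {1..n} \<and> x i \<in> A} = {i\<in>{1..n}. x i \<in> A}" by simp
  then show ?thesis
    unfolding cell_mean_def by (simp add: sum.If_cases Int_def)
qed

lemma cell_mean_cong:
  assumes "\<And>i. i \<in> {1..n} \<Longrightarrow> x i = x' i" "\<And>i. i \<in> {1..n} \<Longrightarrow> y i = y' i"
  shows "cell_mean n x y A = cell_mean n x' y' A"
  unfolding cell_mean_eq_quotient_of_sums
  by (intro arg_cong2[where f = "(/)"] sum.cong) (auto simp: assms)

lemma measurable_cell_mean:
  assumes [measurable]: "\<And>i. i \<in> {1..n} \<Longrightarrow> (\<lambda>\<omega>. y \<omega> i) \<in> borel_measurable N"
    "\<And>i. i \<in> {1..n} \<Longrightarrow> Measurable.pred N (\<lambda>\<omega>. x \<omega> i \<in> A \<omega>)"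
  shows "(\<lambda>\<omega>. cell_mean n (x \<omega>) (y \<omega>) (A \<omega>)) \<in> borel_measurable N"
  unfolding cell_mean_eq_quotient_of_sums
  by (intro borel_measurable_divide borel_measurable_sum measurable_If assms) auto

lemma measurable_mem_cell:
  assumes [measurable]: "\<And>j. j \<in> {1..k} \<Longrightarrow> (\<lambda>\<omega>. u \<omega> j) \<in> borel_measurable N" "x \<in> borel_measurable N"
  shows "Measurable.pred N (\<lambda>\<omega>. x \<omega> \<in> cell (u \<omega>) k j)"
proof -
  have [measurable]: "(\<lambda>\<omega>. order_stat (u \<omega>) k i) \<in> borel_measurable N" for i
    by (rule measurable_order_stat) (rule assms)
  show ?thesis
    unfolding cell_def greaterThanAtMost_iff by measurable
qed

lemma measurable_purt:
  assumes "\<And>i. i \<in> {1..n} \<Longrightarrow> (\<lambda>\<omega>. x \<omega> i) \<in> borel_measurable N"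
    "\<And>i. i \<in> {1..n} \<Longrightarrow> (\<lambda>\<omega>. y \<omega> i) \<in> borel_measurable N"
    "\<And>j. j \<in> {1..k} \<Longrightarrow> (\<lambda>\<omega>. u \<omega> j) \<in> borel_measurable N"
    and t: "t \<in> borel_measurable N"
  shows "(\<lambda>\<omega>. purt n k (x \<omega>) (y \<omega>) (u \<omega>) (t \<omega>)) \<in> borel_measurable N"
proof -
  have "(\<lambda>\<omega>. indicator (cell (u \<omega>) k j) (t \<omega>) :: real) \<in> borel_measurable N" for j
    unfolding indicator_def of_bool_def
    by (rule measurable_If) (use measurable_mem_cell[OF assms(3) t] in \<open>simp_all add: pred_def\<close>)
  then show ?thesis
    unfolding purt_def
    by (intro borel_measurable_sum borel_measurable_times measurable_cell_mean measurable_mem_cell assms)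
qed

lemma purt_cong:
  assumes "\<And>i. i \<in> {1..n} \<Longrightarrow> x i = x' i" "\<And>i. i \<in> {1..n} \<Longrightarrow> y i = y' i"
    "\<And>j. j \<in> {1..k} \<Longrightarrow> u j = u' j"
  shows "purt n k x y u t = purt n k x' y' u' t"
  unfolding purt_def cell_def
  using cell_mean_cong[of n x x' y y', OF assms(1,2)] order_stat_cong[of k u u', OF assms(3)]
  by simp

section \<open>The risk inside one cell\<close>

text \<open>
  One sample size, with the constants that enter the bounds: \<open>m\<close> is a positive lower bound for the density
  and \<open>B\<close> bounds the regression function.
\<close>

locale purt_risk = purt_model +
  fixes s :: "real \<Rightarrow> real" and \<sigma> C M m B :: real
  assumes n_pos: "1 \<le> n"
    and noise_square_integrable: "integrable \<nu> (\<lambda>e. e\<^sup>2)"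
    and noise_mean: "prob_space.expectation \<nu> (\<lambda>e. e) = 0"
    and noise_variance: "prob_space.variance \<nu> (\<lambda>e. e) = \<sigma>\<^sup>2"
    and mu_lower: "\<And>x. x \<in> {0..1} \<Longrightarrow> m \<le> \<mu> x" and m_pos: "0 < m"
    and mu_upper: "\<And>x. x \<in> {0..1} \<Longrightarrow> \<mu> x \<le> M"
    and s_lipschitz: "C-lipschitz_on {0..1} s"
    and s_bound: "\<And>x. x \<in> {0..1} \<Longrightarrow> \<bar>s x\<bar> \<le> B"
begin

text \<open>
  Nothing is known about \<open>s\<close> outside \<open>[0,1]\<close>, not even measurability. This continuous extension agrees
  with \<open>s\<close> at all points that the design or the new point can take.
\<close>

definition s_ext :: "real \<Rightarrow> real" where
  "s_ext x = s (max 0 (min 1 x))"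

lemma s_ext_eq: "x \<in> {0..1} \<Longrightarrow> s_ext x = s x"
  by (simp add: s_ext_def min_absorb2 max_absorb2)

lemma s_ext_measurable [measurable]: "s_ext \<in> borel_measurable borel"
proof -
  have "continuous_on UNIV s_ext"
    unfolding s_ext_def
    by (rule continuous_on_compose2[OF lipschitz_on_continuous_on[OF s_lipschitz]])
      (auto intro!: continuous_intros)
  then show ?thesis by (rule borel_measurable_continuous_onI)
qed

lemma s_ext_bound: "\<bar>s_ext x\<bar> \<le> B"
  unfolding s_ext_def by (rule s_bound) auto

lemma s_ext_lipschitz: "x \<in> {0..1} \<Longrightarrow> y \<in> {0..1} \<Longrightarrow> \<bar>s_ext x - s_ext y\<bar> \<le> C * \<bar>x - y\<bar>"
  using lipschitz_onD[OF s_lipschitz, of x y] by (simp add: s_ext_eq dist_real_def)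

lemma C_nonneg: "0 \<le> C"
  using lipschitz_on_nonneg[OF s_lipschitz] .

lemma M_pos: "0 < M"
  using mu_lower[of 0] mu_upper[of 0] m_pos by simp

lemma B_nonneg: "0 \<le> B"
  using s_bound[of 0] by auto

lemma noise_moments:
  assumes i: "i \<in> {1..n}"
  shows "integrable P (\<lambda>\<omega>. (\<epsilon> i \<omega>)\<^sup>2)" "integrable P (\<epsilon> i)"
    "expectation (\<epsilon> i) = 0" "expectation (\<lambda>\<omega>. (\<epsilon> i \<omega>)\<^sup>2) = \<sigma>\<^sup>2"
proof -
  have [measurable]: "\<epsilon> i \<in> borel_measurable P"
    using i by (rule measurable_sources(2))
  show sq: "integrable P (\<lambda>\<omega>. (\<epsilon> i \<omega>)\<^sup>2)"
    using noise_square_integrable unfolding noise_law[OF i, symmetric]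
    by (subst (asm) integrable_distr_eq) auto
  show "integrable P (\<epsilon> i)"
    by (rule square_integrable_imp_integrable[OF _ sq]) measurable
  show "expectation (\<epsilon> i) = 0"
    using noise_mean unfolding noise_law[OF i, symmetric] by (subst (asm) integral_distr) auto
  show "expectation (\<lambda>\<omega>. (\<epsilon> i \<omega>)\<^sup>2) = \<sigma>\<^sup>2"
    using noise_variance unfolding noise_mean unfolding noise_law[OF i, symmetric]
    by (subst (asm) integral_distr) auto
qed

lemma noise_covariance:
  assumes "i \<in> {1..n}" "j \<in> {1..n}"
  shows "integrable P (\<lambda>\<omega>. \<epsilon> i \<omega> * \<epsilon> j \<omega>)"
    "expectation (\<lambda>\<omega>. \<epsilon> i \<omega> * \<epsilon> j \<omega>) = (if i = j then \<sigma>\<^sup>2 else 0)"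
proof -
  have "integrable P (\<lambda>\<omega>. \<epsilon> i \<omega> * \<epsilon> j \<omega>) \<and>
      expectation (\<lambda>\<omega>. \<epsilon> i \<omega> * \<epsilon> j \<omega>) = (if i = j then \<sigma>\<^sup>2 else 0)"
  proof (cases "i = j")
    case True
    then show ?thesis
      using noise_moments[OF assms(1)] by (simp add: power2_eq_square)
  next
    case False
    let ?I = "{Noise i, Noise j}"
    have ind: "indep_vars (\<lambda>_. borel) rv ?I"
      using assms by (intro indep_vars_subset[OF indep_rv]) (auto simp: sources_def)
    have int: "integrable P (rv v)" if "v \<in> ?I" for v
      using that noise_moments(2) assms by auto
    show ?thesis
      using indep_vars_lebesgue_integral[OF _ ind int] indep_vars_integrable[OF _ ind int]
        noise_moments(3)[OF assms(1)] False
      by simp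
  qed
  then show "integrable P (\<lambda>\<omega>. \<epsilon> i \<omega> * \<epsilon> j \<omega>)"
    "expectation (\<lambda>\<omega>. \<epsilon> i \<omega> * \<epsilon> j \<omega>) = (if i = j then \<sigma>\<^sup>2 else 0)" by auto
qed

text \<open>
  The noise is centred and pairwise uncorrelated, so only the squared shift and the diagonal of the expanded square survive.
\<close>

lemma nn_integral_shifted_noise_squared:
  assumes I: "I \<subseteq> {1..n}"
  shows "(\<integral>\<^sup>+\<omega>. ennreal ((a + (\<Sum>i\<in>I. c i * \<epsilon> i \<omega>))\<^sup>2) \<partial>P) = ennreal (a\<^sup>2 + \<sigma>\<^sup>2 * (\<Sum>i\<in>I. (c i)\<^sup>2))"
proof -
  have fin: "finite I" using I finite_subset by blast
  have eq: "(a + (\<Sum>i\<in>I. c i * \<epsilon> i \<omega>))\<^sup>2 = a\<^sup>2 + 2 * a * (\<Sum>i\<in>I. c i * \<epsilon> i \<omega>)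
      + (\<Sum>i\<in>I. \<Sum>j\<in>I. (c i * c j) * (\<epsilon> i \<omega> * \<epsilon> j \<omega>))" for \<omega>
    by (simp add: power2_sum power2_eq_square[of "\<Sum>i\<in>I. c i * \<epsilon> i \<omega>"] sum_product mult_ac)
  have lin: "integrable P (\<lambda>\<omega>. \<Sum>i\<in>I. c i * \<epsilon> i \<omega>)"
    using I noise_moments(2) by (intro Bochner_Integration.integrable_sum integrable_mult_right) auto
  have quad: "integrable P (\<lambda>\<omega>. (c i * c j) * (\<epsilon> i \<omega> * \<epsilon> j \<omega>))" if "i \<in> I" "j \<in> I" for i j
    using I that by (intro integrable_mult_right noise_covariance(1)) auto
  have quads: "integrable P (\<lambda>\<omega>. \<Sum>i\<in>I. \<Sum>j\<in>I. (c i * c j) * (\<epsilon> i \<omega> * \<epsilon> j \<omega>))"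
    using quad by (intro Bochner_Integration.integrable_sum)
  have lin0: "expectation (\<lambda>\<omega>. \<Sum>i\<in>I. c i * \<epsilon> i \<omega>) = 0"
  proof -
    have "expectation (\<lambda>\<omega>. \<Sum>i\<in>I. c i * \<epsilon> i \<omega>) = (\<Sum>i\<in>I. c i * expectation (\<epsilon> i))"
      using I noise_moments(2) by (subst Bochner_Integration.integral_sum) auto
    then show ?thesis
      using I noise_moments(3) by (simp add: subset_eq)
  qed
  have "expectation (\<lambda>\<omega>. \<Sum>i\<in>I. \<Sum>j\<in>I. (c i * c j) * (\<epsilon> i \<omega> * \<epsilon> j \<omega>))
      = (\<Sum>i\<in>I. \<Sum>j\<in>I. expectation (\<lambda>\<omega>. (c i * c j) * (\<epsilon> i \<omega> * \<epsilon> j \<omega>)))"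
    using quad by (subst Bochner_Integration.integral_sum)
      (auto intro!: Bochner_Integration.integrable_sum sum.cong Bochner_Integration.integral_sum)
  also have "\<dots> = (\<Sum>i\<in>I. \<Sum>j\<in>I. if i = j then (c i)\<^sup>2 * \<sigma>\<^sup>2 else 0)"
  proof (intro sum.cong refl)
    fix i j assume "i \<in> I" "j \<in> I"
    then have "i \<in> {1..n}" "j \<in> {1..n}" using I by auto
    from noise_covariance(2)[OF this]
    show "expectation (\<lambda>\<omega>. (c i * c j) * (\<epsilon> i \<omega> * \<epsilon> j \<omega>)) = (if i = j then (c i)\<^sup>2 * \<sigma>\<^sup>2 else 0)"
      by (simp add: power2_eq_square)
  qed
  also have "\<dots> = \<sigma>\<^sup>2 * (\<Sum>i\<in>I. (c i)\<^sup>2)"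
    using fin by (simp add: sum_distrib_left mult.commute)
  finally have quad0: "expectation (\<lambda>\<omega>. \<Sum>i\<in>I. \<Sum>j\<in>I. (c i * c j) * (\<epsilon> i \<omega> * \<epsilon> j \<omega>))
      = \<sigma>\<^sup>2 * (\<Sum>i\<in>I. (c i)\<^sup>2)" .
  have int: "integrable P (\<lambda>\<omega>. (a + (\<Sum>i\<in>I. c i * \<epsilon> i \<omega>))\<^sup>2)"
    unfolding eq using lin quads by (intro Bochner_Integration.integrable_add integrable_mult_right) auto
  have "expectation (\<lambda>\<omega>. (a + (\<Sum>i\<in>I. c i * \<epsilon> i \<omega>))\<^sup>2)
      = expectation (\<lambda>\<omega>. a\<^sup>2 + 2 * a * (\<Sum>i\<in>I. c i * \<epsilon> i \<omega>))
        + expectation (\<lambda>\<omega>. \<Sum>i\<in>I. \<Sum>j\<in>I. (c i * c j) * (\<epsilon> i \<omega> * \<epsilon> j \<omega>))"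
    unfolding eq using lin quads
    by (intro Bochner_Integration.integral_add Bochner_Integration.integrable_add integrable_mult_right) auto
  also have "expectation (\<lambda>\<omega>. a\<^sup>2 + 2 * a * (\<Sum>i\<in>I. c i * \<epsilon> i \<omega>)) = a\<^sup>2"
    using lin lin0 by (subst Bochner_Integration.integral_add) (auto simp: prob_space)
  finally show ?thesis
    using int quad0 by (subst nn_integral_eq_integral) auto
qed

text \<open>
  The term \<open>3 \<sigma>\<^sup>2\<close> comes from \<open>inverse_le_occupancy\<close>, and \<open>2 B\<^sup>2\<close> pays for empty cells: at
  \<open>N = 0\<close> the second summand of \<open>occupancy_loss\<close> is half of its constant.
\<close>

definition excess_const where "excess_const = 3 * \<sigma>\<^sup>2 + 2 * B\<^sup>2"

lemma excess_const_nonneg: "0 \<le> excess_const"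
  by (simp add: excess_const_def)

lemma occupancy_loss_nonneg: "0 \<le> occupancy_loss (\<sigma>\<^sup>2) excess_const N"
  using excess_const_nonneg by (simp add: occupancy_loss_def)

text \<open>
  For fixed design and new point, the error is a deterministic shift of size at most \<open>C l\<close> plus the average of
  \<open>N\<close> noise variables. An empty cell has the estimate \<open>0\<close>, hence the error \<open>s(t)\<^sup>2 \<le> B\<^sup>2\<close>.
\<close>

lemma noise_averaged_cell_risk_le:
  assumes A: "A \<subseteq> {0..1}" and diam: "\<And>x y. x \<in> A \<Longrightarrow> y \<in> A \<Longrightarrow> \<bar>x - y\<bar> \<le> l" and t: "t \<in> A"
  shows "(\<integral>\<^sup>+\<omega>. ennreal ((cell_mean n x (\<lambda>i. s_ext (x i) + \<epsilon> i \<omega>) A - s_ext t)\<^sup>2) \<partial>P)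
    \<le> ennreal (C\<^sup>2 * l\<^sup>2 + occupancy_loss (\<sigma>\<^sup>2) excess_const (card {i\<in>{1..n}. x i \<in> A}))"
proof -
  define I where "I = {i\<in>{1..n}. x i \<in> A}"
  have I: "I \<subseteq> {1..n}" "finite I" by (auto simp: I_def)
  let ?N = "card I"
  show ?thesis
  proof (cases "I = {}")
    case True
    \<comment> \<open>Sum and cardinality are both \<open>0\<close>, and \<open>0 / 0 = 0\<close>.\<close>
    have "cell_mean n x y A = 0" for y
      using True unfolding cell_mean_def I_def by simp
    then have "(\<integral>\<^sup>+\<omega>. ennreal ((cell_mean n x (\<lambda>i. s_ext (x i) + \<epsilon> i \<omega>) A - s_ext t)\<^sup>2) \<partial>P)
        = ennreal ((s_ext t)\<^sup>2)"
      by (simp add: emeasure_space_1)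
    also have "\<dots> \<le> ennreal (C\<^sup>2 * l\<^sup>2 + occupancy_loss (\<sigma>\<^sup>2) excess_const ?N)"
    proof (rule ennreal_leI)
      have "(s_ext t)\<^sup>2 \<le> B\<^sup>2"
        using s_ext_bound[of t] B_nonneg by (intro abs_le_square_iff[THEN iffD1]) simp
      moreover have "0 \<le> C\<^sup>2 * l\<^sup>2" "0 \<le> \<sigma>\<^sup>2" by auto
      moreover have "occupancy_loss (\<sigma>\<^sup>2) excess_const ?N = 5 / 2 * \<sigma>\<^sup>2 + B\<^sup>2"
        using True by (simp add: occupancy_loss_def excess_const_def field_simps)
      ultimately show "(s_ext t)\<^sup>2 \<le> C\<^sup>2 * l\<^sup>2 + occupancy_loss (\<sigma>\<^sup>2) excess_const ?N"
        by linarith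
    qed
    finally show ?thesis by (simp add: I_def)
  next
    case False
    then have N: "0 < ?N" "1 \<le> ?N" using I by (auto simp: Suc_le_eq card_gt_0_iff)
    define a where "a = (\<Sum>i\<in>I. s_ext (x i) - s_ext t) / ?N"
    have mean: "cell_mean n x y A = (\<Sum>i\<in>I. y i) / ?N" for y
      unfolding cell_mean_def I_def by simp
    have decomp: "cell_mean n x (\<lambda>i. s_ext (x i) + \<epsilon> i \<omega>) A - s_ext t = a + (\<Sum>i\<in>I. (1 / ?N) * \<epsilon> i \<omega>)" for \<omega>
      using N by (simp add: mean a_def sum.distrib sum_subtractf field_simps flip: sum_divide_distrib)
    have "\<bar>\<Sum>i\<in>I. s_ext (x i) - s_ext t\<bar> \<le> (\<Sum>i\<in>I. C * l)"
    proof (rule order.trans[OF sum_abs], rule sum_mono)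
      fix i assume "i \<in> I"
      then have xi: "x i \<in> A" by (simp add: I_def)
      then have "\<bar>s_ext (x i) - s_ext t\<bar> \<le> C * \<bar>x i - t\<bar>"
        using A t by (intro s_ext_lipschitz) auto
      also have "\<dots> \<le> C * l"
        using diam[OF xi t] C_nonneg by (intro mult_left_mono)
      finally show "\<bar>s_ext (x i) - s_ext t\<bar> \<le> C * l" .
    qed
    then have "\<bar>a\<bar> \<le> C * l"
      using N by (simp add: a_def field_simps)
    then have "a\<^sup>2 \<le> (C * l)\<^sup>2"
      by (intro abs_le_square_iff[THEN iffD1]) linarith
    moreover have "\<sigma>\<^sup>2 * (\<Sum>i\<in>I. (1 / real ?N)\<^sup>2) \<le> occupancy_loss (\<sigma>\<^sup>2) excess_const ?N"
    proof -
      have "\<sigma>\<^sup>2 * (\<Sum>i\<in>I. (1 / real ?N)\<^sup>2) = \<sigma>\<^sup>2 * (1 / ?N)"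
        using N by (simp add: power2_eq_square)
      also have "\<dots> \<le> \<sigma>\<^sup>2 * (1 / (real ?N + 1) + 3 / ((real ?N + 1) * (real ?N + 2)))"
        by (intro mult_left_mono inverse_le_occupancy N) simp
      also have "\<dots> = occupancy_loss (\<sigma>\<^sup>2) (3 * \<sigma>\<^sup>2) ?N"
        by (simp add: occupancy_loss_def distrib_left)
      also have "\<dots> \<le> occupancy_loss (\<sigma>\<^sup>2) excess_const ?N"
        unfolding occupancy_loss_def by (intro add_left_mono divide_right_mono) (auto simp: excess_const_def)
      finally show ?thesis .
    qed
    ultimately show ?thesis
      unfolding decomp nn_integral_shifted_noise_squared[OF I(1)]
      by (intro ennreal_leI) (simp add: I_def power_mult_distrib)
  qed
qed

lemma prob_X'_interval:
  assumes ab: "0 \<le> a" "a \<le> b" "b \<le> 1"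
  shows "m * (b - a) \<le> prob {\<omega> \<in> space P. X' \<omega> \<in> {a<..b}}"
    "prob {\<omega> \<in> space P. X' \<omega> \<in> {a<..b}} \<le> M * (b - a)"
proof -
  let ?p = "prob {\<omega> \<in> space P. X' \<omega> \<in> {a<..b}}"
  have "ennreal ?p = emeasure (distr P lborel X') {a<..b}"
    unfolding emeasure_eq_measure[symmetric]
    by (subst emeasure_distr) (auto intro!: arg_cong[where f = "emeasure P"])
  also have "\<dots> = (\<integral>\<^sup>+x. ennreal (\<mu> x * indicator {0..1} x) * indicator {a<..b} x \<partial>lborel)"
    unfolding distributed_distr_eq_density[OF X'_density]
    using distributed_borel_measurable[OF X'_density] by (intro emeasure_density) auto
  finally have p: "ennreal ?p = (\<integral>\<^sup>+x. ennreal (\<mu> x * indicator {0..1} x) * indicator {a<..b} x \<partial>lborel)" .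
  have const: "(\<integral>\<^sup>+x. ennreal c * indicator {a<..b} x \<partial>lborel) = ennreal (c * (b - a))" if "0 \<le> c" for c :: real
    using ab that by (subst nn_integral_cmult_indicator) (auto simp: ennreal_mult)
  have "ennreal (m * (b - a)) \<le> ennreal ?p"
    unfolding p const[OF less_imp_le[OF m_pos], symmetric] using ab
    by (intro nn_integral_mono) (auto simp: indicator_def intro!: ennreal_leI mu_lower)
  then show "m * (b - a) \<le> ?p" by simp
  have "ennreal ?p \<le> ennreal (M * (b - a))"
    unfolding p const[OF less_imp_le[OF M_pos], symmetric] using ab
    by (intro nn_integral_mono) (auto simp: indicator_def intro!: ennreal_leI mu_upper)
  then show "?p \<le> M * (b - a)"
    using M_pos ab by (subst (asm) ennreal_le_iff) auto
qed

text \<open>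
  The noise is integrated out first, then the design separately from the new point. The factor
  \<open>p = P(X \<in> A)\<close> contributed by the new point cancels the \<open>1/p\<close> of the inverse moments, and together with
  \<open>p \<le> M (b - a)\<close> it makes the squared bias cubic in the length.
\<close>

lemma cell_risk_le:
  assumes ab: "0 \<le> a" "a \<le> b" "b \<le> 1" and \<delta>: "0 < \<delta>"
  defines "A \<equiv> {a<..b}"
  shows "(\<integral>\<^sup>+\<omega>. ennreal ((cell_mean n (\<lambda>i. X i \<omega>) (\<lambda>i. s_ext (X i \<omega>) + \<epsilon> i \<omega>) A - s_ext (X' \<omega>))\<^sup>2)
      * indicator A (X' \<omega>) \<partial>P)
    \<le> ennreal (M * C\<^sup>2 * (b - a) ^ 3 + \<sigma>\<^sup>2 / n + excess_const / n * (of_bool (b - a \<le> \<delta>) + 1 / (n * m * \<delta>)))"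
proof -
  let ?p = "prob {\<omega> \<in> space P. X' \<omega> \<in> A}"
  let ?N = "\<lambda>\<omega>. card {i\<in>{1..n}. X i \<omega> \<in> A}"
  let ?h = "occupancy_loss (\<sigma>\<^sup>2) excess_const"
  let ?S1 = "Design ` {1..n} \<union> {New_Point}" and ?S2 = "Noise ` {1..n}"
  have [measurable]: "A \<in> sets borel" by (simp add: A_def)
  have A: "A \<subseteq> {0..1}" using ab by (auto simp: A_def)
  have p: "?p \<in> {0..1}" by simp
  define f where "f v w = ennreal ((cell_mean n (\<lambda>i. v (Design i)) (\<lambda>i. s_ext (v (Design i)) + w (Noise i)) A
      - s_ext (v New_Point))\<^sup>2) * indicator A (v New_Point)" for v w :: "source \<Rightarrow> real"
  have f_meas: "case_prod f \<in> borel_measurable (PiM ?S1 (\<lambda>_. borel) \<Otimes>\<^sub>M PiM ?S2 (\<lambda>_. borel))" (is "_ \<in> borel_measurable ?N2")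
  proof -
    have d: "(\<lambda>p. fst p (Design i)) \<in> borel_measurable ?N2" if "i \<in> {1..n}" for i
      using that by (intro measurable_fst_component) auto
    have [measurable]: "(\<lambda>p. fst p New_Point) \<in> borel_measurable ?N2"
      by (intro measurable_fst_component) auto
    have e: "(\<lambda>p. snd p (Noise i)) \<in> borel_measurable ?N2" if "i \<in> {1..n}" for i
      using that by (intro measurable_snd_component) auto
    have [measurable]: "(\<lambda>p. cell_mean n (\<lambda>i. fst p (Design i)) (\<lambda>i. s_ext (fst p (Design i)) + snd p (Noise i)) A)
        \<in> borel_measurable ?N2"
    proof (rule measurable_cell_mean)
      fix i assume i: "i \<in> {1..n}"
      note [measurable] = d[OF i] e[OF i]
      show "(\<lambda>p. s_ext (fst p (Design i)) + snd p (Noise i)) \<in> borel_measurable ?N2"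
        "Measurable.pred ?N2 (\<lambda>p. fst p (Design i) \<in> A)" by measurable
    qed
    show ?thesis
      unfolding f_def case_prod_beta by measurable
  qed
  have "(\<integral>\<^sup>+\<omega>. ennreal ((cell_mean n (\<lambda>i. X i \<omega>) (\<lambda>i. s_ext (X i \<omega>) + \<epsilon> i \<omega>) A - s_ext (X' \<omega>))\<^sup>2)
      * indicator A (X' \<omega>) \<partial>P)
    = (\<integral>\<^sup>+\<omega>. \<integral>\<^sup>+\<omega>'. ennreal ((cell_mean n (\<lambda>i. X i \<omega>) (\<lambda>i. s_ext (X i \<omega>) + \<epsilon> i \<omega>') A - s_ext (X' \<omega>))\<^sup>2)
      * indicator A (X' \<omega>) \<partial>P \<partial>P)"
  proof (rule nn_integral_decouple[OF _ _ _ f_meas])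
    fix \<omega> \<omega>'
    have "cell_mean n (\<lambda>i. restrict (\<lambda>v. rv v \<omega>) ?S1 (Design i))
        (\<lambda>i. s_ext (restrict (\<lambda>v. rv v \<omega>) ?S1 (Design i)) + restrict (\<lambda>v. rv v \<omega>') ?S2 (Noise i)) A
      = cell_mean n (\<lambda>i. X i \<omega>) (\<lambda>i. s_ext (X i \<omega>) + \<epsilon> i \<omega>') A"
      by (rule cell_mean_cong) auto
    then show "f (restrict (\<lambda>v. rv v \<omega>) ?S1) (restrict (\<lambda>v. rv v \<omega>') ?S2)
      = ennreal ((cell_mean n (\<lambda>i. X i \<omega>) (\<lambda>i. s_ext (X i \<omega>) + \<epsilon> i \<omega>') A - s_ext (X' \<omega>))\<^sup>2)
        * indicator A (X' \<omega>)"
      by (simp add: f_def)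
  qed (auto simp: sources_def)
  also have "\<dots> \<le> (\<integral>\<^sup>+\<omega>. indicator A (X' \<omega>) * ennreal (C\<^sup>2 * (b - a)\<^sup>2 + ?h (?N \<omega>)) \<partial>P)"
  proof (rule nn_integral_mono)
    fix \<omega>
    show "(\<integral>\<^sup>+\<omega>'. ennreal ((cell_mean n (\<lambda>i. X i \<omega>) (\<lambda>i. s_ext (X i \<omega>) + \<epsilon> i \<omega>') A - s_ext (X' \<omega>))\<^sup>2)
        * indicator A (X' \<omega>) \<partial>P) \<le> indicator A (X' \<omega>) * ennreal (C\<^sup>2 * (b - a)\<^sup>2 + ?h (?N \<omega>))"
    proof (cases "X' \<omega> \<in> A")
      case True
      have "\<bar>x - y\<bar> \<le> b - a" if "x \<in> A" "y \<in> A" for x y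
        using that by (auto simp: A_def)
      from noise_averaged_cell_risk_le[OF A this True, of "\<lambda>i. X i \<omega>"] show ?thesis
        using True by simp
    qed simp
  qed
  also have "\<dots> = (\<integral>\<^sup>+\<omega>. \<integral>\<^sup>+\<omega>'. indicator A (X' \<omega>) * ennreal (C\<^sup>2 * (b - a)\<^sup>2 + ?h (?N \<omega>')) \<partial>P \<partial>P)"
  proof (rule nn_integral_decouple)
    let ?N3 = "PiM {New_Point} (\<lambda>_. borel :: real measure) \<Otimes>\<^sub>M PiM (Design ` {1..n}) (\<lambda>_. borel :: real measure)"
    have [measurable]: "(\<lambda>p. fst p New_Point) \<in> borel_measurable ?N3"
      by (intro measurable_fst_component) auto
    have [measurable]: "(\<lambda>p. card {i\<in>{1..n}. snd p (Design i) \<in> A}) \<in> measurable ?N3 (count_space UNIV)"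
      by (intro measurable_card_Collect pred_sets2[OF _ measurable_snd_component]) auto
    show "case_prod (\<lambda>v w. indicator A (v New_Point) *
        ennreal (C\<^sup>2 * (b - a)\<^sup>2 + ?h (card {i\<in>{1..n}. w (Design i) \<in> A}))) \<in> borel_measurable ?N3"
      unfolding case_prod_beta by measurable
  qed (auto simp: sources_def cong: conj_cong)
  also have "\<dots> = (\<integral>\<^sup>+\<omega>. indicator {\<omega> \<in> space P. X' \<omega> \<in> A} \<omega> *
      (\<integral>\<^sup>+N. ennreal (C\<^sup>2 * (b - a)\<^sup>2 + ?h N) \<partial>binomial_pmf n ?p) \<partial>P)"
  proof (rule nn_integral_cong)
    fix \<omega> assume "\<omega> \<in> space P"
    moreover have "(\<integral>\<^sup>+\<omega>'. ennreal (C\<^sup>2 * (b - a)\<^sup>2 + ?h (?N \<omega>')) \<partial>P)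
        = (\<integral>\<^sup>+N. ennreal (C\<^sup>2 * (b - a)\<^sup>2 + ?h N) \<partial>binomial_pmf n ?p)"
      using nn_integral_cell_count[of "{1..n}" A "\<lambda>N. ennreal (C\<^sup>2 * (b - a)\<^sup>2 + ?h N)"] by simp
    ultimately show "(\<integral>\<^sup>+\<omega>'. indicator A (X' \<omega>) * ennreal (C\<^sup>2 * (b - a)\<^sup>2 + ?h (?N \<omega>')) \<partial>P)
      = indicator {\<omega> \<in> space P. X' \<omega> \<in> A} \<omega> * (\<integral>\<^sup>+N. ennreal (C\<^sup>2 * (b - a)\<^sup>2 + ?h N) \<partial>binomial_pmf n ?p)"
      by (cases "X' \<omega> \<in> A") auto
  qed
  also have "\<dots> = ennreal ?p * (\<integral>\<^sup>+N. ennreal (C\<^sup>2 * (b - a)\<^sup>2 + ?h N) \<partial>binomial_pmf n ?p)"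
    by (subst nn_integral_multc) (auto simp: emeasure_eq_measure)
  also have "(\<integral>\<^sup>+N. ennreal (C\<^sup>2 * (b - a)\<^sup>2 + ?h N) \<partial>binomial_pmf n ?p)
      = ennreal (C\<^sup>2 * (b - a)\<^sup>2 + measure_pmf.expectation (binomial_pmf n ?p) ?h)"
    using p occupancy_loss_nonneg by (subst nn_integral_eq_integral) auto
  also have "ennreal ?p * \<dots> = ennreal (?p * (C\<^sup>2 * (b - a)\<^sup>2) + ?p * measure_pmf.expectation (binomial_pmf n ?p) ?h)"
    using p occupancy_loss_nonneg
    by (subst ennreal_mult[symmetric]) (auto simp: distrib_left intro!: add_nonneg_nonneg integral_nonneg_AE)
  also have "\<dots> \<le> ennreal (M * C\<^sup>2 * (b - a) ^ 3 + \<sigma>\<^sup>2 / n + excess_const / n * (of_bool (b - a \<le> \<delta>) + 1 / (n * m * \<delta>)))"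
  proof (rule ennreal_leI)
    have lower: "m * (b - a) \<le> ?p" and upper: "?p \<le> M * (b - a)"
      using prob_X'_interval[OF ab] by (simp_all add: A_def)
    have "?p * (C\<^sup>2 * (b - a)\<^sup>2) \<le> (M * (b - a)) * (C\<^sup>2 * (b - a)\<^sup>2)"
      using upper by (intro mult_right_mono) auto
    also have "\<dots> = M * C\<^sup>2 * (b - a) ^ 3"
      by (simp add: power2_eq_square power3_eq_cube)
    moreover have "?p * measure_pmf.expectation (binomial_pmf n ?p) ?h
        \<le> \<sigma>\<^sup>2 / n + excess_const / n * (of_bool (b - a \<le> \<delta>) + 1 / (n * m * \<delta>))"
      using p n_pos excess_const_nonneg lower m_pos \<delta> ab
      by (intro expected_occupancy_loss_le) (auto simp: A_def)
    ultimately show "?p * (C\<^sup>2 * (b - a)\<^sup>2) + ?p * measure_pmf.expectation (binomial_pmf n ?p) ?h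
      \<le> M * C\<^sup>2 * (b - a) ^ 3 + \<sigma>\<^sup>2 / n + excess_const / n * (of_bool (b - a \<le> \<delta>) + 1 / (n * m * \<delta>))"
      by linarith
  qed
  finally show ?thesis .
qed

end

section \<open>The risk of the tree\<close>

lemma purt_error_eq_sum_over_cells:
  assumes u: "u \<in> {1..k} \<rightarrow> {0..1}" and t: "t \<in> {0<..1}"
  shows "ennreal ((purt n k x y u t - c)\<^sup>2)
    = (\<Sum>j=0..k. ennreal ((cell_mean n x y (cell u k j) - c)\<^sup>2) * indicator (cell u k j) t)"
proof -
  obtain j where j: "j \<in> {0..k}" "t \<in> cell u k j"
    using ex_cell[OF t] by blast
  have mem: "t \<in> cell u k i \<longleftrightarrow> i = j" for i
    using cell_unique[OF u _ j(2)] j(2) by blast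
  have "purt n k x y u t = cell_mean n x y (cell u k j)"
    using j(1) by (simp add: purt_def indicator_def mem if_distrib if_distribR cong: if_cong)
  moreover have "(\<Sum>i=0..k. ennreal ((cell_mean n x y (cell u k i) - c)\<^sup>2) * indicator (cell u k i) t)
      = ennreal ((cell_mean n x y (cell u k j) - c)\<^sup>2)"
    using j(1) by (simp add: indicator_def mem if_distrib if_distribR cong: if_cong)
  ultimately show ?thesis by simp
qed

context purt_risk
begin

definition risk_integrand :: "'a \<Rightarrow> real" where
  "risk_integrand \<omega> = (purt n k (\<lambda>i. X i \<omega>) (\<lambda>i. s (X i \<omega>) + \<epsilon> i \<omega>) (\<lambda>j. U j \<omega>) (X' \<omega>) - s (X' \<omega>))\<^sup>2"

lemma risk_integrand_eq:
  assumes "\<omega> \<in> space P"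
  shows "risk_integrand \<omega>
    = (purt n k (\<lambda>i. X i \<omega>) (\<lambda>i. s_ext (X i \<omega>) + \<epsilon> i \<omega>) (\<lambda>j. U j \<omega>) (X' \<omega>) - s_ext (X' \<omega>))\<^sup>2"
proof -
  have "purt n k (\<lambda>i. X i \<omega>) (\<lambda>i. s (X i \<omega>) + \<epsilon> i \<omega>) (\<lambda>j. U j \<omega>) (X' \<omega>)
      = purt n k (\<lambda>i. X i \<omega>) (\<lambda>i. s_ext (X i \<omega>) + \<epsilon> i \<omega>) (\<lambda>j. U j \<omega>) (X' \<omega>)"
    using X_range[OF _ assms] by (intro purt_cong) (auto simp: s_ext_eq)
  then show ?thesis
    using s_ext_eq[OF X'_range[OF assms]] by (simp add: risk_integrand_def)
qed

lemma risk_integrand_measurable: "risk_integrand \<in> borel_measurable P"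
proof -
  have [measurable]: "(\<lambda>\<omega>. purt n k (\<lambda>i. X i \<omega>) (\<lambda>i. s_ext (X i \<omega>) + \<epsilon> i \<omega>) (\<lambda>j. U j \<omega>) (X' \<omega>))
      \<in> borel_measurable P"
  proof (rule measurable_purt)
    fix i assume i: "i \<in> {1..n}"
    note [measurable] = measurable_sources(1,2)[OF i]
    show "(\<lambda>\<omega>. s_ext (X i \<omega>) + \<epsilon> i \<omega>) \<in> borel_measurable P" by measurable
  qed (rule measurable_sources, assumption?)+
  have "(\<lambda>\<omega>. (purt n k (\<lambda>i. X i \<omega>) (\<lambda>i. s_ext (X i \<omega>) + \<epsilon> i \<omega>) (\<lambda>j. U j \<omega>) (X' \<omega>) - s_ext (X' \<omega>))\<^sup>2)
      \<in> borel_measurable P"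
    by measurable
  then show ?thesis
    by (subst measurable_cong[OF risk_integrand_eq]) auto
qed

text \<open>
  The point \<open>0\<close> lies in no cell.
\<close>

lemma AE_X'_pos: "AE \<omega> in P. X' \<omega> \<in> {0<..1}"
proof -
  have "AE x in distr P lborel X'. x \<noteq> 0"
    unfolding distributed_distr_eq_density[OF X'_density]
    using distributed_borel_measurable[OF X'_density] AE_lborel_singleton[of 0]
    by (subst AE_density) auto
  then have "AE \<omega> in P. X' \<omega> \<noteq> 0"
    by (rule AE_distrD[rotated]) simp
  moreover have "AE \<omega> in P. X' \<omega> \<in> {0..1}"
    using X'_range by (intro AE_I2)
  ultimately show ?thesis
    by eventually_elim auto
qed

text \<open>
  The lengths of the cells are numbers here: the split points are fixed, and only the sample and the new point
  are random.
\<close>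

lemma risk_given_splits_le:
  assumes u: "u \<in> {1..k} \<rightarrow> {0..1}" and \<delta>: "0 < \<delta>"
  shows "(\<integral>\<^sup>+\<omega>. ennreal ((purt n k (\<lambda>i. X i \<omega>) (\<lambda>i. s_ext (X i \<omega>) + \<epsilon> i \<omega>) u (X' \<omega>) - s_ext (X' \<omega>))\<^sup>2) \<partial>P)
    \<le> (\<Sum>j=0..k. ennreal (M * C\<^sup>2 * cell_length u k j ^ 3 + \<sigma>\<^sup>2 / n
          + excess_const / n * (of_bool (cell_length u k j \<le> \<delta>) + 1 / (n * m * \<delta>))))"
proof -
  let ?loss = "\<lambda>j \<omega>. ennreal ((cell_mean n (\<lambda>i. X i \<omega>) (\<lambda>i. s_ext (X i \<omega>) + \<epsilon> i \<omega>) (cell u k j)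
      - s_ext (X' \<omega>))\<^sup>2) * indicator (cell u k j) (X' \<omega>)"
  have meas: "?loss j \<in> borel_measurable P" for j
  proof -
    have [measurable]: "(\<lambda>\<omega>. cell_mean n (\<lambda>i. X i \<omega>) (\<lambda>i. s_ext (X i \<omega>) + \<epsilon> i \<omega>) (cell u k j)) \<in> borel_measurable P"
    proof (rule measurable_cell_mean)
      fix i assume i: "i \<in> {1..n}"
      note [measurable] = measurable_sources(1,2)[OF i]
      show "(\<lambda>\<omega>. s_ext (X i \<omega>) + \<epsilon> i \<omega>) \<in> borel_measurable P" "Measurable.pred P (\<lambda>\<omega>. X i \<omega> \<in> cell u k j)"
        by measurable
    qed
    show ?thesis by measurable
  qed
  have "(\<integral>\<^sup>+\<omega>. ennreal ((purt n k (\<lambda>i. X i \<omega>) (\<lambda>i. s_ext (X i \<omega>) + \<epsilon> i \<omega>) u (X' \<omega>) - s_ext (X' \<omega>))\<^sup>2) \<partial>P)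
      = (\<integral>\<^sup>+\<omega>. (\<Sum>j=0..k. ?loss j \<omega>) \<partial>P)"
  proof (rule nn_integral_cong_AE)
    show "AE \<omega> in P. ennreal ((purt n k (\<lambda>i. X i \<omega>) (\<lambda>i. s_ext (X i \<omega>) + \<epsilon> i \<omega>) u (X' \<omega>) - s_ext (X' \<omega>))\<^sup>2)
        = (\<Sum>j=0..k. ?loss j \<omega>)"
      using AE_X'_pos by eventually_elim (rule purt_error_eq_sum_over_cells[OF u])
  qed
  also have "\<dots> = (\<Sum>j=0..k. \<integral>\<^sup>+\<omega>. ?loss j \<omega> \<partial>P)"
    by (rule nn_integral_sum) (rule meas)
  also have "\<dots> \<le> (\<Sum>j=0..k. ennreal (M * C\<^sup>2 * cell_length u k j ^ 3 + \<sigma>\<^sup>2 / n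
          + excess_const / n * (of_bool (cell_length u k j \<le> \<delta>) + 1 / (n * m * \<delta>))))"
    unfolding cell_def cell_length_def
    using order_stat_mem[OF u]
    by (intro sum_mono cell_risk_le \<delta> order_stat_mono[OF u]) auto
  finally show ?thesis .
qed

text \<open>
  Independence of the split points from everything else allows them to be drawn from a copy of their own, so
  that the inner integral has fixed cells and the previous bound applies.
\<close>

lemma nn_integral_risk_integrand_le:
  assumes \<delta>: "0 < \<delta>"
  shows "(\<integral>\<^sup>+\<omega>. ennreal (risk_integrand \<omega>) \<partial>P)
    \<le> (\<integral>\<^sup>+\<omega>. (\<Sum>j=0..k. ennreal (M * C\<^sup>2 * cell_length (\<lambda>i. U i \<omega>) k j ^ 3 + \<sigma>\<^sup>2 / n
          + excess_const / n * (of_bool (cell_length (\<lambda>i. U i \<omega>) k j \<le> \<delta>) + 1 / (n * m * \<delta>)))) \<partial>P)"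
proof -
  let ?S1 = "Split ` {1..k}" and ?S2 = "Design ` {1..n} \<union> Noise ` {1..n} \<union> {New_Point}"
  define g where "g \<omega> \<omega>' = ennreal ((purt n k (\<lambda>i. X i \<omega>') (\<lambda>i. s_ext (X i \<omega>') + \<epsilon> i \<omega>') (\<lambda>j. U j \<omega>) (X' \<omega>')
      - s_ext (X' \<omega>'))\<^sup>2)" for \<omega> \<omega>'
  define f where "f v w = ennreal ((purt n k (\<lambda>i. w (Design i)) (\<lambda>i. s_ext (w (Design i)) + w (Noise i))
      (\<lambda>j. v (Split j)) (w New_Point) - s_ext (w New_Point))\<^sup>2)" for v w :: "source \<Rightarrow> real"
  have f_meas: "case_prod f \<in> borel_measurable (PiM ?S1 (\<lambda>_. borel) \<Otimes>\<^sub>M PiM ?S2 (\<lambda>_. borel))" (is "_ \<in> borel_measurable ?N2")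
  proof -
    have d: "(\<lambda>p. snd p (Design i)) \<in> borel_measurable ?N2" if "i \<in> {1..n}" for i
      using that by (intro measurable_snd_component) auto
    have [measurable]: "(\<lambda>p. snd p New_Point) \<in> borel_measurable ?N2"
      by (intro measurable_snd_component) auto
    have e: "(\<lambda>p. snd p (Noise i)) \<in> borel_measurable ?N2" if "i \<in> {1..n}" for i
      using that by (intro measurable_snd_component) auto
    have [measurable]: "(\<lambda>p. purt n k (\<lambda>i. snd p (Design i)) (\<lambda>i. s_ext (snd p (Design i)) + snd p (Noise i))
        (\<lambda>j. fst p (Split j)) (snd p New_Point)) \<in> borel_measurable ?N2"
    proof (rule measurable_purt)
      fix i assume i: "i \<in> {1..n}"
      note [measurable] = d[OF i] e[OF i]
      show "(\<lambda>p. snd p (Design i)) \<in> borel_measurable ?N2"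
        "(\<lambda>p. s_ext (snd p (Design i)) + snd p (Noise i)) \<in> borel_measurable ?N2"
        by measurable
    next
      fix j assume "j \<in> {1..k}"
      then show "(\<lambda>p. fst p (Split j)) \<in> borel_measurable ?N2"
        by (intro measurable_fst_component) auto
    qed measurable
    show ?thesis
      unfolding f_def case_prod_beta by measurable
  qed
  have "(\<integral>\<^sup>+\<omega>. ennreal (risk_integrand \<omega>) \<partial>P) = (\<integral>\<^sup>+\<omega>. g \<omega> \<omega> \<partial>P)"
    by (intro nn_integral_cong) (simp add: g_def risk_integrand_eq)
  also have "\<dots> = (\<integral>\<^sup>+\<omega>. \<integral>\<^sup>+\<omega>'. g \<omega> \<omega>' \<partial>P \<partial>P)"
  proof (rule nn_integral_decouple[OF _ _ _ f_meas])
    fix \<omega> \<omega>'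
    let ?v = "restrict (\<lambda>v. rv v \<omega>) ?S1" and ?w = "restrict (\<lambda>v. rv v \<omega>') ?S2"
    have "purt n k (\<lambda>i. ?w (Design i)) (\<lambda>i. s_ext (?w (Design i)) + ?w (Noise i)) (\<lambda>j. ?v (Split j)) (?w New_Point)
        = purt n k (\<lambda>i. X i \<omega>') (\<lambda>i. s_ext (X i \<omega>') + \<epsilon> i \<omega>') (\<lambda>j. U j \<omega>) (?w New_Point)"
      by (rule purt_cong) auto
    then show "f ?v ?w = g \<omega> \<omega>'"
      by (simp add: f_def g_def)
  qed (auto simp: sources_def)
  also have "\<dots> \<le> (\<integral>\<^sup>+\<omega>. (\<Sum>j=0..k. ennreal (M * C\<^sup>2 * cell_length (\<lambda>i. U i \<omega>) k j ^ 3 + \<sigma>\<^sup>2 / n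
          + excess_const / n * (of_bool (cell_length (\<lambda>i. U i \<omega>) k j \<le> \<delta>) + 1 / (n * m * \<delta>)))) \<partial>P)"
    unfolding g_def
  proof (rule nn_integral_mono_AE)
    show "AE \<omega> in P. (\<integral>\<^sup>+\<omega>'. ennreal ((purt n k (\<lambda>i. X i \<omega>') (\<lambda>i. s_ext (X i \<omega>') + \<epsilon> i \<omega>') (\<lambda>j. U j \<omega>) (X' \<omega>')
        - s_ext (X' \<omega>'))\<^sup>2) \<partial>P)
      \<le> (\<Sum>j=0..k. ennreal (M * C\<^sup>2 * cell_length (\<lambda>i. U i \<omega>) k j ^ 3 + \<sigma>\<^sup>2 / n
          + excess_const / n * (of_bool (cell_length (\<lambda>i. U i \<omega>) k j \<le> \<delta>) + 1 / (n * m * \<delta>))))"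
      using AE_U_range by eventually_elim (rule risk_given_splits_le[OF _ \<delta>])
  qed
  finally show ?thesis .
qed

text \<open>
  The lengths enter only through the sum of their cubes and the number of short cells, whose expectations are
  known; every other summand is the same for all \<open>k + 1\<close> cells.
\<close>

lemma risk_le:
  assumes \<delta>: "0 < \<delta>"
  shows "integrable P risk_integrand"
    and "expectation risk_integrand \<le> \<sigma>\<^sup>2 * real (k + 1) / n + 6 * M * C\<^sup>2 / (real (k + 1))\<^sup>2
      + excess_const / n * (2 + 2 * (real k)\<^sup>2 * \<delta> + real (k + 1) / (n * m * \<delta>))"
proof -
  let ?l = "\<lambda>\<omega> j. cell_length (\<lambda>i. U i \<omega>) k j"
  let ?\<alpha> = "M * C\<^sup>2" and ?\<beta> = "\<sigma>\<^sup>2 / n + excess_const / n * (1 / (n * m * \<delta>))" and ?\<gamma> = "excess_const / n"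
  let ?R = "?\<alpha> * (6 / ((real k + 1) * (real k + 2))) + real (k + 1) * ?\<beta> + ?\<gamma> * (2 + 2 * (real k)\<^sup>2 * \<delta>)"
  have nonneg: "0 \<le> ?\<alpha>" "0 \<le> ?\<beta>" "0 \<le> ?\<gamma>"
    using M_pos excess_const_nonneg m_pos \<delta> by auto
  have [measurable]: "(\<lambda>\<omega>. ?l \<omega> j) \<in> borel_measurable P" for j
    unfolding cell_length_def
    by (intro borel_measurable_diff measurable_order_stat measurable_sources)
  have card_meas: "(\<lambda>\<omega>. card {j\<in>{0..k}. ?l \<omega> j \<le> \<delta>}) \<in> measurable P (count_space UNIV)"
    by (rule measurable_card_Collect) measurable
  have "(\<integral>\<^sup>+\<omega>. ennreal (risk_integrand \<omega>) \<partial>P)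
      \<le> (\<integral>\<^sup>+\<omega>. (\<Sum>j=0..k. ennreal (?\<alpha> * ?l \<omega> j ^ 3 + \<sigma>\<^sup>2 / n
          + excess_const / n * (of_bool (?l \<omega> j \<le> \<delta>) + 1 / (n * m * \<delta>)))) \<partial>P)"
    by (rule nn_integral_risk_integrand_le[OF \<delta>])
  also have "\<dots> = (\<integral>\<^sup>+\<omega>. ennreal ?\<alpha> * (\<Sum>j=0..k. ennreal (?l \<omega> j ^ 3)) + ennreal (real (k + 1) * ?\<beta>)
      + ennreal ?\<gamma> * of_nat (card {j\<in>{0..k}. ?l \<omega> j \<le> \<delta>}) \<partial>P)"
  proof (rule nn_integral_cong_AE)
    show "AE \<omega> in P. (\<Sum>j=0..k. ennreal (?\<alpha> * ?l \<omega> j ^ 3 + \<sigma>\<^sup>2 / n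
          + excess_const / n * (of_bool (?l \<omega> j \<le> \<delta>) + 1 / (n * m * \<delta>))))
      = ennreal ?\<alpha> * (\<Sum>j=0..k. ennreal (?l \<omega> j ^ 3)) + ennreal (real (k + 1) * ?\<beta>)
      + ennreal ?\<gamma> * of_nat (card {j\<in>{0..k}. ?l \<omega> j \<le> \<delta>})"
      using AE_U_range
    proof eventually_elim
      case (elim \<omega>)
      have l: "0 \<le> ?l \<omega> j ^ 3" for j
        unfolding cell_length_def using order_stat_mono[OF elim, of j "Suc j"] by simp
      have "(\<Sum>j=0..k. ennreal (?\<alpha> * ?l \<omega> j ^ 3 + \<sigma>\<^sup>2 / n + excess_const / n * (of_bool (?l \<omega> j \<le> \<delta>) + 1 / (n * m * \<delta>))))
          = (\<Sum>j=0..k. ennreal (?\<alpha> * ?l \<omega> j ^ 3 + ?\<beta> + ?\<gamma> * of_bool (?l \<omega> j \<le> \<delta>)))"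
        by (intro sum.cong refl arg_cong[where f = ennreal]) (simp add: distrib_left)
      also have "\<dots> = ennreal (\<Sum>j=0..k. ?\<alpha> * ?l \<omega> j ^ 3 + ?\<beta> + ?\<gamma> * of_bool (?l \<omega> j \<le> \<delta>))"
        by (intro sum_ennreal add_nonneg_nonneg mult_nonneg_nonneg nonneg l) simp
      also have "(\<Sum>j=0..k. ?\<alpha> * ?l \<omega> j ^ 3 + ?\<beta> + ?\<gamma> * of_bool (?l \<omega> j \<le> \<delta>))
          = ?\<alpha> * (\<Sum>j=0..k. ?l \<omega> j ^ 3) + real (k + 1) * ?\<beta> + ?\<gamma> * (\<Sum>j=0..k. of_bool (?l \<omega> j \<le> \<delta>))"
        by (simp only: sum.distrib sum_distrib_left) (simp add: distrib_left)
      also have "(\<Sum>j=0..k. of_bool (?l \<omega> j \<le> \<delta>)) = real (card {j\<in>{0..k}. ?l \<omega> j \<le> \<delta>})"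
        by (simp add: of_bool_def sum.If_cases Int_def)
      also have "ennreal (?\<alpha> * (\<Sum>j=0..k. ?l \<omega> j ^ 3) + real (k + 1) * ?\<beta> + ?\<gamma> * real (card {j\<in>{0..k}. ?l \<omega> j \<le> \<delta>}))
          = ennreal (?\<alpha> * (\<Sum>j=0..k. ?l \<omega> j ^ 3)) + ennreal (real (k + 1) * ?\<beta>)
            + ennreal (?\<gamma> * real (card {j\<in>{0..k}. ?l \<omega> j \<le> \<delta>}))"
        using l nonneg by (simp only: ennreal_plus mult_nonneg_nonneg add_nonneg_nonneg sum_nonneg of_nat_0_le_iff)
      also have "ennreal (?\<alpha> * (\<Sum>j=0..k. ?l \<omega> j ^ 3)) = ennreal ?\<alpha> * (\<Sum>j=0..k. ennreal (?l \<omega> j ^ 3))"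
        using l nonneg by (simp only: ennreal_mult sum_nonneg sum_ennreal)
      also have "ennreal (?\<gamma> * real (card {j\<in>{0..k}. ?l \<omega> j \<le> \<delta>})) = ennreal ?\<gamma> * of_nat (card {j\<in>{0..k}. ?l \<omega> j \<le> \<delta>})"
        using nonneg by (simp only: ennreal_mult of_nat_0_le_iff ennreal_of_nat_eq_real_of_nat)
      finally show ?case .
    qed
  qed
  also have "\<dots> = ennreal ?\<alpha> * (\<integral>\<^sup>+\<omega>. (\<Sum>j=0..k. ennreal (?l \<omega> j ^ 3)) \<partial>P) + ennreal (real (k + 1) * ?\<beta>)
      + ennreal ?\<gamma> * (\<integral>\<^sup>+\<omega>. of_nat (card {j\<in>{0..k}. ?l \<omega> j \<le> \<delta>}) \<partial>P)"
  proof -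
    have [measurable]: "(\<lambda>\<omega>. of_nat (card {j\<in>{0..k}. ?l \<omega> j \<le> \<delta>}) :: ennreal) \<in> borel_measurable P"
      using card_meas by (rule measurable_compose) simp
    show ?thesis
      by (simp add: nn_integral_add nn_integral_cmult emeasure_space_1 del: nn_integral_sum)
  qed
  also have "\<dots> \<le> ennreal ?\<alpha> * ennreal (6 / ((real k + 1) * (real k + 2))) + ennreal (real (k + 1) * ?\<beta>)
      + ennreal ?\<gamma> * ennreal (2 + 2 * (real k)\<^sup>2 * \<delta>)"
    using expectation_sum_cubed_lengths_le expectation_number_of_short_cells_le[of \<delta>] \<delta>
    by (intro add_mono mult_left_mono) auto
  also have "\<dots> = ennreal ?R"
  proof -
    have "0 \<le> 6 / ((real k + 1) * (real k + 2))" "0 \<le> 2 + 2 * (real k)\<^sup>2 * \<delta>" "0 \<le> real (k + 1)"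
      using \<delta> by auto
    with nonneg show ?thesis
      by (simp only: ennreal_plus ennreal_mult mult_nonneg_nonneg add_nonneg_nonneg)
  qed
  finally have le: "(\<integral>\<^sup>+\<omega>. ennreal (risk_integrand \<omega>) \<partial>P) \<le> ennreal ?R" .
  have pos: "0 \<le> risk_integrand \<omega>" for \<omega>
    by (simp add: risk_integrand_def)
  show int: "integrable P risk_integrand"
    using risk_integrand_measurable pos le
    by (intro integrableI_nonneg) (auto intro: order.strict_trans1)
  have R0: "0 \<le> ?R"
    using nonneg \<delta> M_pos m_pos by (intro add_nonneg_nonneg mult_nonneg_nonneg) auto
  have "ennreal (expectation risk_integrand) \<le> ennreal ?R"
    using le pos by (subst nn_integral_eq_integral[OF int, symmetric]) auto
  then have "expectation risk_integrand \<le> ?R"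
    using R0 by (subst (asm) ennreal_le_iff) auto
  also have "?\<alpha> * (6 / ((real k + 1) * (real k + 2))) \<le> ?\<alpha> * (6 / ((real k + 1) * (real k + 1)))"
    using nonneg by (intro mult_left_mono divide_left_mono) auto
  finally show "expectation risk_integrand \<le> \<sigma>\<^sup>2 * real (k + 1) / n + 6 * M * C\<^sup>2 / (real (k + 1))\<^sup>2
      + excess_const / n * (2 + 2 * (real k)\<^sup>2 * \<delta> + real (k + 1) / (n * m * \<delta>))"
    by (simp add: power2_eq_square distrib_left add_ac mult_ac)
qed

end

section \<open>The remainder and the theorem\<close>

text \<open>
  Once \<open>k \<ge> 1\<close>, the three summands divided by \<open>k/n\<close> are at most \<open>2 K\<close> times \<open>1/k\<close>, \<open>(k/n)\<^sup>1\<^sup>/\<^sup>2\<close> and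
  \<open>(2 k/n)\<^sup>1\<^sup>/\<^sup>2/m\<close>. The geometric mean \<open>\<delta>\<close> balances the last two; \<open>k + 1\<close> instead of \<open>k\<close>
  keeps it positive when \<open>k = 0\<close>.
\<close>

lemma remainder_smallo:
  fixes k :: "nat \<Rightarrow> nat" and K m :: real
  assumes k_at_top: "filterlim k at_top sequentially"
    and k_small: "(\<lambda>n. real (k n) / real n) \<longlonglongrightarrow> 0"
    and "0 \<le> K" and "0 < m"
  defines "\<delta> \<equiv> \<lambda>n. 1 / sqrt (real n * real (k n + 1))"
  shows "(\<lambda>n. K / n * (2 + 2 * (real (k n))\<^sup>2 * \<delta> n + real (k n + 1) / (n * m * \<delta> n)))
    \<in> o(\<lambda>n. real (k n) / real n)"
proof (rule smalloI_tendsto)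
  have k_pos: "eventually (\<lambda>n. 1 \<le> k n) sequentially"
    using k_at_top by (simp add: filterlim_at_top)
  have n_pos: "eventually (\<lambda>n. 1 \<le> n) sequentially"
    by (rule eventually_ge_at_top)
  show "eventually (\<lambda>n. real (k n) / real n \<noteq> 0) sequentially"
    using k_pos n_pos by eventually_elim auto
  let ?q = "\<lambda>n. real (k n) / real n"
  let ?r = "\<lambda>n. K / n * (2 + 2 * (real (k n))\<^sup>2 * \<delta> n + real (k n + 1) / (n * m * \<delta> n)) / ?q n"
  have "filterlim (\<lambda>n. real (k n)) at_top sequentially"
    by (rule filterlim_compose[OF filterlim_real_sequentially k_at_top])
  then have "(\<lambda>n. 2 / real (k n)) \<longlonglongrightarrow> 0"
    by (rule real_tendsto_divide_at_top[OF tendsto_const])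
  moreover have "(\<lambda>n. sqrt (?q n)) \<longlonglongrightarrow> 0"
    using tendsto_real_sqrt[OF k_small] by simp
  ultimately have "(\<lambda>n. K * (2 / real (k n) + 2 * sqrt (?q n) + 2 / m * (sqrt 2 * sqrt (?q n))))
      \<longlonglongrightarrow> K * (0 + 2 * 0 + 2 / m * (sqrt 2 * 0))"
    by (intro tendsto_intros)
  then have upper: "(\<lambda>n. K * (2 / real (k n) + 2 * sqrt (?q n) + 2 / m * (sqrt 2 * sqrt (?q n)))) \<longlonglongrightarrow> 0"
    by simp
  have "eventually (\<lambda>n. 0 \<le> ?r n) sequentially"
    using assms by (intro always_eventually allI) (auto simp: \<delta>_def intro!: mult_nonneg_nonneg divide_nonneg_nonneg add_nonneg_nonneg)
  moreover have "eventually (\<lambda>n. ?r n \<le> K * (2 / real (k n) + 2 * sqrt (?q n) + 2 / m * (sqrt 2 * sqrt (?q n)))) sequentially"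
    using k_pos n_pos
  proof eventually_elim
    case (elim n)
    let ?k = "real (k n)" and ?n = "real n"
    have pos: "0 < ?k" "0 < ?n" "1 \<le> ?k" using elim by auto
    have d: "0 < \<delta> n" using pos by (simp add: \<delta>_def)
    have "?k * \<delta> n \<le> sqrt (?q n)"
    proof -
      have "?k * \<delta> n \<le> ?k * (1 / sqrt (?n * ?k))"
        unfolding \<delta>_def using pos by (intro mult_left_mono divide_left_mono) auto
      also have "\<dots> = sqrt (?q n)"
        using pos by (simp add: real_sqrt_mult real_sqrt_divide field_simps)
      finally show ?thesis .
    qed
    moreover have "(?k + 1) / (?k * (?n * m * \<delta> n)) \<le> 2 / m * (sqrt 2 * sqrt (?q n))"
    proof -
      have "1 / (?n * \<delta> n) = sqrt (?n * (?k + 1)) / (sqrt ?n * sqrt ?n)"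
        by (simp add: \<delta>_def add.commute)
      also have "\<dots> = sqrt ((?k + 1) / ?n)"
        using pos by (simp only: real_sqrt_mult real_sqrt_divide, intro mult_divide_mult_cancel_left) simp
      also have "\<dots> \<le> sqrt (2 * ?q n)"
        using pos by (intro real_sqrt_le_mono) (simp add: field_simps)
      finally have a: "1 / (?n * \<delta> n) \<le> sqrt 2 * sqrt (?q n)"
        by (simp only: real_sqrt_mult)
      have "(?k + 1) / (?k * (?n * m * \<delta> n)) = ((?k + 1) / ?k / m) * (1 / (?n * \<delta> n))"
        by simp
      also have "\<dots> \<le> (2 / m) * (sqrt 2 * sqrt (?q n))"
        using pos a d \<open>0 < m\<close> by (intro mult_mono divide_right_mono) (auto simp: field_simps)
      finally show ?thesis .
    qed
    ultimately have "2 / ?k + 2 * (?k * \<delta> n) + (?k + 1) / (?k * (?n * m * \<delta> n))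
        \<le> 2 / ?k + 2 * sqrt (?q n) + 2 / m * (sqrt 2 * sqrt (?q n))"
      by linarith
    moreover have "?r n = K * (2 / ?k + 2 * (?k * \<delta> n) + (?k + 1) / (?k * (?n * m * \<delta> n)))"
      using pos d \<open>0 < m\<close> by (simp add: field_simps power2_eq_square)
    ultimately show ?case
      using \<open>0 \<le> K\<close> by (simp only: mult_left_mono)
  qed
  ultimately show "?r \<longlonglongrightarrow> 0"
    by (rule tendsto_sandwich[OF _ _ tendsto_const upper])
qed

theorem theorem1:
  fixes k :: "nat \<Rightarrow> nat"
    and \<mu> s :: "real \<Rightarrow> real"
    and M C \<sigma> :: real
    and \<nu> :: "real measure"
    and P :: "nat \<Rightarrow> 'a measure"
    and X \<epsilon> U :: "nat \<Rightarrow> nat \<Rightarrow> 'a \<Rightarrow> real"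
    and X' :: "nat \<Rightarrow> 'a \<Rightarrow> real"
  assumes model: "\<And>n. n \<ge> 1 \<Longrightarrow> purt_model (P n) n (k n) \<mu> \<nu> (X n) (\<epsilon> n) (U n) (X' n)"
    and noise_square_integrable: "integrable \<nu> (\<lambda>e. e\<^sup>2)"
    and noise_mean: "prob_space.expectation \<nu> (\<lambda>e. e) = 0"
    and noise_variance: "prob_space.variance \<nu> (\<lambda>e. e) = \<sigma>\<^sup>2"
    and mu_continuous: "continuous_on {0..1} \<mu>"
    and mu_bounds: "\<And>x. x \<in> {0..1} \<Longrightarrow> 0 < \<mu> x \<and> \<mu> x \<le> M"
    and s_lipschitz: "C-lipschitz_on {0..1} s"
    and k_at_top: "filterlim k at_top sequentially"
    and k_small: "(\<lambda>n. real (k n) / real n) \<longlonglongrightarrow> 0"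
  defines "sq_err \<equiv> \<lambda>n \<omega>. (purt n (k n) (\<lambda>i. X n i \<omega>) (\<lambda>i. s (X n i \<omega>) + \<epsilon> n i \<omega>)
      (\<lambda>j. U n j \<omega>) (X' n \<omega>) - s (X' n \<omega>))\<^sup>2"
  shows "\<exists>r. r \<in> o(\<lambda>n. real (k n) / real n) \<and>
    (\<forall>n\<ge>1. integrable (P n) (sq_err n) \<and>
      prob_space.expectation (P n) (sq_err n)
        \<le> \<sigma>\<^sup>2 * real (k n + 1) / real n + 6 * M * C\<^sup>2 / (real (k n + 1))\<^sup>2 + r n)"
proof -
  obtain x0 where x0: "x0 \<in> {0..1}" "\<And>x. x \<in> {0..1} \<Longrightarrow> \<mu> x0 \<le> \<mu> x"
    using continuous_attains_inf[OF compact_Icc _ mu_continuous] by auto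
  define m where "m = \<mu> x0"
  have m: "0 < m"
    using mu_bounds[OF x0(1)] by (simp add: m_def)
  define B where "B = \<bar>s 0\<bar> + C"
  have s_bound: "\<bar>s x\<bar> \<le> B" if "x \<in> {0..1}" for x
  proof -
    have "\<bar>s x - s 0\<bar> \<le> C * \<bar>x\<bar>"
      using lipschitz_onD[OF s_lipschitz that, of 0] by (simp add: dist_real_def)
    also have "\<dots> \<le> C * 1"
      using that lipschitz_on_nonneg[OF s_lipschitz] by (intro mult_left_mono) auto
    finally show ?thesis by (simp add: B_def)
  qed
  define c where "c = 3 * \<sigma>\<^sup>2 + 2 * B\<^sup>2"
  \<comment> \<open>The length up to which a cell counts as short.\<close>
  define \<delta> where "\<delta> n = 1 / sqrt (real n * real (k n + 1))" for n
  define r where "r n = c / n * (2 + 2 * (real (k n))\<^sup>2 * \<delta> n + real (k n + 1) / (n * m * \<delta> n))" for n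
  have "r \<in> o(\<lambda>n. real (k n) / real n)"
    unfolding r_def \<delta>_def using m by (intro remainder_smallo k_at_top k_small) (auto simp: c_def)
  moreover have "integrable (P n) (sq_err n) \<and>
      prob_space.expectation (P n) (sq_err n)
        \<le> \<sigma>\<^sup>2 * real (k n + 1) / real n + 6 * M * C\<^sup>2 / (real (k n + 1))\<^sup>2 + r n" if n: "1 \<le> n" for n
  proof -
    interpret purt_risk "P n" n "k n" \<mu> \<nu> "X n" "\<epsilon> n" "U n" "X' n" s \<sigma> C M m B
      by (rule purt_risk.intro[OF model[OF n]], unfold_locales)
        (use n noise_square_integrable noise_mean noise_variance mu_bounds x0(2) m s_lipschitz s_bound
          in \<open>auto simp: m_def\<close>)
    have "0 < \<delta> n"
      using n by (simp add: \<delta>_def)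
    from risk_le[OF this] show ?thesis
      unfolding sq_err_def risk_integrand_def[abs_def, symmetric] r_def c_def excess_const_def
      by simp
  qed
  ultimately show ?thesis by blast
qed

end
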